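(* Let $f:(0,\infty)\to(0,\infty)$ be continuously differentiable with $f'(x)>0$ for all $x>0$, $f'$ decreasing, and $f'(x)\to 0$ as $x\to\infty$. Suppose that $f$ is regularly varying at infinity with index $1$ and that $$\lim_{x\to\infty}\frac{xf'(x)}{f(x)}=1.$$ Let $\mu$ be a positive finite Borel measure on $[0,\infty)$ with $M:=\int_{[0,\infty)}\mu(ds)\in(0,\infty)$. Let $\psi>0$ and let $x$ be the unique continuous solution of $$x'(t)=\int_{[0,t]}\mu(ds)\,f(x(t-s)),\quad t\ge 0;\qquad x(0)=\psi.$$ Let $F(x)=\int_1^x \frac{1}{f(u)}\,du$ for $x>0$, and define, for $x\ge 1$, $$K(x)=\int_1^x\left\{\frac{f(v)}{v}\int_{[F(x)/M-F(v)/M,\;F(x)/M]}\mu(ds)\right\}dv.$$ If $$\lim_{t\to\infty}\frac{x(t)}{F^{-1}(Mt)}=1,$$ then $$\lim_{x\to\infty}\frac{f(x)}{x}\int_{[0,F(x)/M]}\int_{[s,\infty)}\mu(du)\,ds=0 \quad\text{and}\quad \lim_{x\to\infty}\frac{f(x)}{x}\int_1^x K(u)\frac{1}{f^2(u)}\,du=0.$$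
   Context: A measurable function $g:(0,\infty)\to(0,\infty)$ is regularly varying at infinity with index $\beta\in\mathbb{R}$ if $g(\kappa t)/g(t)\to\kappa^\beta$ as $t\to\infty$ for every $\kappa>0$. The function $F$ is strictly increasing and $F(x)\to\infty$ as $x\to\infty$ (since $f(x)/x\to0$), so $F^{-1}(Mt)$ is defined for all $t\ge0$. Since $\mu$ may have atoms, the solution is understood as a continuous (locally absolutely continuous) function $x:[0,\infty)\to(0,\infty)$ satisfying the equation in integrated form, i.e. for almost every $t\ge0$. *)

theory Defs
  imports "HOL-Analysis.Analysis"
begin

definition regularly_varying_at_infinity :: "real \<Rightarrow> (real \<Rightarrow> real) \<Rightarrow> bool" where
  "regularly_varying_at_infinity \<beta> g \<longleftrightarrow>
     g \<in> borel_measurable (restrict_space borel {0<..}) \<and>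
     (\<forall>t>0. 0 < g t) \<and>
     (\<forall>\<kappa>>0. ((\<lambda>t. g (\<kappa> * t) / g t) \<longlongrightarrow> \<kappa> powr \<beta>) at_top)"

definition finite_Borel_measure_halfline :: "real measure \<Rightarrow> bool" where
  "finite_Borel_measure_halfline \<mu> \<longleftrightarrow>
     finite_measure \<mu> \<and> sets \<mu> = sets (restrict_space borel {0..})"

text \<open>
  Since \<open>\<mu>\<close> may have atoms, the right-hand side of the equation need not be continuous in time,
  so the equation is imposed in integrated form. For continuous \<open>f\<close> and \<open>x\<close> the inner integral is a
  locally bounded measurable function of \<open>u\<close>, so a solution is locally absolutely continuous and
  satisfies the differential equation almost everywhere. Taking \<open>t = 0\<close> gives \<open>x 0 = \<psi>\<close>.
\<close>
definition volterra_solution ::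
    "(real \<Rightarrow> real) \<Rightarrow> real measure \<Rightarrow> real \<Rightarrow> (real \<Rightarrow> real) \<Rightarrow> bool" where
  "volterra_solution f \<mu> \<psi> x \<longleftrightarrow>
     continuous_on {0..} x \<and>
     (\<forall>t\<ge>0. 0 < x t) \<and>
     (\<forall>t\<ge>0. x t = \<psi> + (LBINT u:{0..t}. (LINT s:{0..u}|\<mu>. f (x (u - s)))))"

text \<open>The interval integral is oriented, so \<open>F f x\<close> is negative for \<open>0 < x < 1\<close>.\<close>
definition F :: "(real \<Rightarrow> real) \<Rightarrow> real \<Rightarrow> real" where
  "F f x = (LBINT u=1..x. 1 / f u)"

definition F_inv :: "(real \<Rightarrow> real) \<Rightarrow> real \<Rightarrow> real" where
  "F_inv f = inv_into {0<..} (F f)"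

definition total_mass :: "real measure \<Rightarrow> real" where
  "total_mass \<mu> = measure \<mu> {0..}"

definition K :: "(real \<Rightarrow> real) \<Rightarrow> real measure \<Rightarrow> real \<Rightarrow> real" where
  "K f \<mu> x =
     (LBINT v:{1..x}. f v / v *
        measure \<mu> {F f x / total_mass \<mu> - F f v / total_mass \<mu> .. F f x / total_mass \<mu>})"

end

theory Submission
  imports Defs
begin

text \<open>
  Write \<open>e u = f (x u)\<close>, with \<open>x\<close> frozen at \<open>\<psi>\<close> for negative times. Since \<open>x' / e \<le> M - B\<close> with the delay
  loss \<open>B u = \<integral> (1 - e (u - s) / e u) \<mu>(ds) \<ge> 0\<close>, integration gives
  \<open>\<integral>\<^sub>0\<^sup>t B \<le> M t - F (x t) + F \<psi>\<close>. Concavity of \<open>f\<close> makes \<open>f y / y\<close> decreasing, so \<open>x t \<sim> F\<^sup>-\<^sup>1 (M t)\<close> forces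
  \<open>f (x t) / x t * (M t - F (x t)) \<rightarrow> 0\<close>. Hence any integral up to \<open>y = x t\<close> that is at most a constant plus a
  multiple of \<open>\<integral>\<^sub>0\<^sup>t B\<close> vanishes after multiplication with \<open>f y / y\<close>.

  For the first limit, lags \<open>s \<ge> u\<close> alone give \<open>\<mu> [u, \<infinity>) \<le> 2 B u\<close> for large \<open>u\<close>. For the second,
  \<open>K (x u) \<le> 8 e u * B u\<close> for large \<open>u\<close>: with \<open>G' v = f v / v\<close>, \<open>K\<close> integrates over \<open>\<mu>(ds)\<close> the increment of
  \<open>G\<close> along time \<open>s\<close> of the flow \<open>y' = M f y\<close>; the solution moves at least at half the speed of that flow,
  and \<open>G\<close> is eventually convex along the flow with \<open>G' \<le> 2 f'\<close>.
\<close>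

subsection \<open>Sublinear growth functions\<close>

text \<open>The fundamental theorem gives a derivative within a compact interval; one that contains
  \<open>1\<close> and has \<open>y\<close> in its interior turns this into a derivative at
  \<open>y\<close>. Serves both \<open>F f\<close> and \<open>G\<close>.\<close>

lemma interval_integral_has_real_derivative:
  fixes h :: "real \<Rightarrow> real" and y :: real
  assumes h: "continuous_on {0<..} h" and y: "0 < y"
  shows "((\<lambda>z. LBINT u=1..z. h u) has_real_derivative h y) (at y)"
proof -
  define a b where "a = min 1 y / 2" and "b = max 1 y + 1"
  have ab: "0 < a" "a < 1" "a < y" "1 < b" "y < b"
    using y by (auto simp: a_def b_def min_def)
  have "((\<lambda>z. LBINT u=1..z. h u) has_vector_derivative h y) (at y within {a..b})"
    unfolding one_ereal_def using ab
    by (intro interval_integral_FTC2 continuous_on_subset[OF h]) auto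
  moreover have "at y within {a..b} = at y"
    using ab by (intro at_within_interior) (auto simp: interior_atLeastAtMost_real)
  ultimately show ?thesis
    by (simp add: has_real_derivative_iff_has_vector_derivative)
qed

locale sublinear_growth =
  fixes f f' :: "real \<Rightarrow> real"
  assumes f_pos: "\<And>y. 0 < y \<Longrightarrow> 0 < f y"
    and f_deriv: "\<And>y. 0 < y \<Longrightarrow> (f has_real_derivative f' y) (at y)"
    and f'_pos: "\<And>y. 0 < y \<Longrightarrow> 0 < f' y"
    and f'_decreasing: "antimono_on {0<..} f'"
    and f'_lim: "(f' \<longlongrightarrow> 0) at_top"
    and f_elasticity: "((\<lambda>y. y * f' y / f y) \<longlongrightarrow> 1) at_top"
begin

lemma f_cont: "continuous_on {0<..} f"
  by (intro continuous_at_imp_continuous_on ballI)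
    (auto intro: DERIV_isCont f_deriv)

lemma f_mono: "f a \<le> f b" if "0 < a" "a \<le> b"
proof (rule DERIV_nonneg_imp_nondecreasing[of a b f])
  fix y assume "a \<le> y" "y \<le> b"
  then show "\<exists>D. (f has_real_derivative D) (at y) \<and> 0 \<le> D"
    using that f_deriv[of y] f'_pos[of y] by (intro exI[of _ "f' y"]) auto
qed (use that in auto)

text \<open>By the mean value theorem and monotonicity of \<open>f'\<close>, \<open>f y\<close>
  exceeds \<open>(y - a) * f' y\<close> whenever \<open>0 < a < y\<close>. Nothing is known about
  \<open>f\<close> at \<open>0\<close>, so \<open>a\<close> is merely taken small, at the price of
  the slack \<open>\<epsilon>\<close>.\<close>

lemma mult_f'_le_f: "y * f' y \<le> f y" if y: "0 < y"
proof (rule field_le_epsilon)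
  fix \<epsilon> :: real assume \<epsilon>: "0 < \<epsilon>"
  define a where "a = min (y/2) (\<epsilon> / f' y)"
  have a: "0 < a" "a < y" "a * f' y \<le> \<epsilon>"
    using y \<epsilon> f'_pos[OF y] by (auto simp: a_def min_def field_simps)
  obtain z where z: "a < z" "z < y" "f y - f a = (y - a) * f' z"
    using MVT2[of a y f f'] a f_deriv by auto
  have "(y - a) * f' y \<le> (y - a) * f' z"
    using z a y f'_decreasing by (intro mult_left_mono) (auto simp: monotone_on_def)
  then show "y * f' y \<le> f y + \<epsilon>"
    using z f_pos[OF a(1)] a(3) by (simp add: algebra_simps)
qed

lemma ratio_antimono: "f b / b \<le> f a / a" if "0 < a" "a \<le> b"
proof (rule DERIV_nonpos_imp_nonincreasing[of a b "\<lambda>y. f y / y"])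
  fix y assume "a \<le> y" "y \<le> b"
  then have y: "0 < y" using that by simp
  have "((\<lambda>y. f y / y) has_real_derivative (f' y * y - f y) / (y * y)) (at y)"
    using y f_deriv[OF y] by (auto intro!: derivative_eq_intros)
  moreover have "(f' y * y - f y) / (y * y) \<le> 0"
    using mult_f'_le_f[OF y] y by (auto simp: divide_simps mult.commute)
  ultimately show "\<exists>D. ((\<lambda>y. f y / y) has_real_derivative D) (at y) \<and> D \<le> 0" by blast
qed (use that in auto)

text \<open>The ratio is \<open>f' y\<close> divided by the elasticity
  \<open>y * f' y / f y\<close>, a quotient of quantities tending to \<open>0\<close> and
  \<open>1\<close>.\<close>

lemma ratio_tendsto_0: "((\<lambda>y. f y / y) \<longlongrightarrow> 0) at_top"
proof -
  have "((\<lambda>y. f' y / (y * f' y / f y)) \<longlongrightarrow> 0 / 1) at_top"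
    by (intro tendsto_divide f'_lim f_elasticity) auto
  moreover have "\<forall>\<^sub>F y in at_top. f' y / (y * f' y / f y) = f y / y"
    using eventually_gt_at_top[of 0]
    by eventually_elim (use f_pos f'_pos in \<open>force simp: field_simps\<close>)
  ultimately show ?thesis using tendsto_cong by force
qed

section \<open>The time function \<open>F f\<close> and its inverse\<close>

lemma F_deriv: "(F f has_real_derivative 1 / f y) (at y)" if "0 < y"
  unfolding F_def using that f_pos
  by (intro interval_integral_has_real_derivative continuous_intros f_cont) force+

lemma F_cont: "continuous_on {0<..} (F f)"
  by (intro continuous_at_imp_continuous_on ballI)
    (auto intro: DERIV_isCont F_deriv)

lemma F_1 [simp]: "F f 1 = 0"
  by (simp add: F_def one_ereal_def)

lemma F_diff_mvt:
  assumes "0 < a" "a < b"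
  obtains z where "a < z" "z < b" "F f b - F f a = (b - a) / f z"
  using MVT2[of a b "F f" "\<lambda>y. 1 / f y"] assms F_deriv by auto

text \<open>The increment is \<open>b - a\<close> times an intermediate value of
  \<open>1 / f\<close>; since \<open>f\<close> increases, the endpoint values bound it on either
  side, here and in \<open>F_diff_le\<close>.\<close>

lemma F_diff_ge: "(b - a) / f b \<le> F f b - F f a" if "0 < a" "a \<le> b"
proof (cases "a = b")
  case False
  with that obtain z where z: "a < z" "z < b" "F f b - F f a = (b - a) / f z"
    using F_diff_mvt[of a b] by auto
  show ?thesis unfolding z(3)
    using z that by (intro divide_left_mono f_mono mult_pos_pos f_pos) auto
qed auto

lemma F_diff_le: "F f b - F f a \<le> (b - a) / f a" if "0 < a" "a \<le> b"
proof (cases "a = b")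
  case False
  with that obtain z where z: "a < z" "z < b" "F f b - F f a = (b - a) / f z"
    using F_diff_mvt[of a b] by auto
  show ?thesis unfolding z(3)
    using z that by (intro divide_left_mono f_mono mult_pos_pos f_pos) auto
qed auto

lemma F_strict_mono:
  assumes "0 < a" "a < b"
  shows "F f a < F f b"
proof -
  obtain z where "a < z" "F f b - F f a = (b - a) / f z"
    using F_diff_mvt[OF assms] .
  moreover from this have "0 < (b - a) / f z" using assms f_pos by auto
  ultimately show ?thesis by simp
qed

lemma F_le_iff: "F f a \<le> F f b \<longleftrightarrow> a \<le> b" if "0 < a" "0 < b"
  using F_strict_mono[of a b] F_strict_mono[of b a] that by (cases a b rule: linorder_cases) auto

text \<open>For \<open>y \<ge> 2\<close>, \<open>F f y\<close> is at least
  \<open>(y - 1) / f y\<close>, hence at least half the reciprocal of \<open>f y / y\<close>, which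
  tends to \<open>0\<close> from above.\<close>

lemma F_at_top: "filterlim (F f) at_top at_top"
proof -
  have "filterlim (\<lambda>y. f y / y) (at_right 0) at_top"
    using ratio_tendsto_0 eventually_gt_at_top[of 0]
    by (auto intro!: tendsto_imp_filterlim_at_right eventually_mono[OF eventually_gt_at_top[of 0]] divide_pos_pos f_pos)
  then have *: "filterlim (\<lambda>y. (1/2) * inverse (f y / y)) at_top at_top"
    by (intro filterlim_tendsto_pos_mult_at_top[OF tendsto_const]
      filterlim_compose[OF filterlim_inverse_at_top_right]) auto
  show ?thesis
  proof (rule filterlim_at_top_mono[OF *])
    show "\<forall>\<^sub>F y in at_top. (1/2) * inverse (f y / y) \<le> F f y"
      using eventually_ge_at_top[of 2]
    proof eventually_elim
      case (elim y)
      have "(1/2) * inverse (f y / y) = (y / 2) / f y" by simp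
      also have "\<dots> \<le> (y - 1) / f y"
        using elim f_pos[of y] by (intro divide_right_mono) auto
      also have "\<dots> \<le> F f y" using F_diff_ge[of 1 y] elim by simp
      finally show ?case .
    qed
  qed
qed

text \<open>As \<open>F f 1 = 0\<close> and \<open>F f\<close> is unbounded, the intermediate value
  theorem puts every \<open>z \<ge> 0\<close> into its range, so \<open>inv_into\<close> picks a
  genuine preimage.\<close>

lemma F_inv:
  assumes "0 \<le> z"
  shows "0 < F_inv f z" "F f (F_inv f z) = z"
proof -
  obtain b where b: "1 \<le> b" "z \<le> F f b"
    using eventually_conj[OF eventually_ge_at_top[of 1] F_at_top[unfolded filterlim_at_top, rule_format, of z]]
    by (auto simp: eventually_at_top_linorder)
  then have "\<exists>y\<ge>1. y \<le> b \<and> F f y = z"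
    using assms by (intro IVT') (auto intro!: continuous_on_subset[OF F_cont])
  then have "z \<in> F f ` {0<..}" by (auto intro!: image_eqI)
  then show "0 < F_inv f z" "F f (F_inv f z) = z"
    unfolding F_inv_def using inv_into_into[of z "F f" "{0<..}"] f_inv_into_f[of z "F f" "{0<..}"] by auto
qed

text \<open>Both properties hold once the elasticity exceeds \<open>1/2\<close>: the first is a
  rearrangement, and it makes the derivative \<open>f y * (2 * f' y - f y / y) / y\<close> of the
  square of \<open>f y\<close> over \<open>y\<close> nonnegative.\<close>

lemma eventually_elastic:
  obtains v\<^sub>0 where "1 \<le> v\<^sub>0" "\<And>v. v\<^sub>0 \<le> v \<Longrightarrow> f v / v \<le> 2 * f' v"
    "\<And>a b. v\<^sub>0 \<le> a \<Longrightarrow> a \<le> b \<Longrightarrow> (f a)\<^sup>2 / a \<le> (f b)\<^sup>2 / b"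
proof -
  have "\<forall>\<^sub>F y in at_top. 1/2 < y * f' y / f y"
    using f_elasticity by (rule order_tendstoD) simp
  then obtain c where c: "\<And>y. c \<le> y \<Longrightarrow> 1/2 < y * f' y / f y"
    by (auto simp: eventually_at_top_linorder)
  define v\<^sub>0 where "v\<^sub>0 = max 1 c"
  have v0: "1 \<le> v\<^sub>0" by (simp add: v\<^sub>0_def)
  have *: "f v / v \<le> 2 * f' v" if "v\<^sub>0 \<le> v" for v
    using c[of v] f_pos[of v] that by (auto simp: v\<^sub>0_def field_simps)
  have "(f a)\<^sup>2 / a \<le> (f b)\<^sup>2 / b" if "v\<^sub>0 \<le> a" "a \<le> b" for a b
  proof (rule DERIV_nonneg_imp_nondecreasing[of a b "\<lambda>y. (f y)\<^sup>2 / y"])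
    fix y assume "a \<le> y" "y \<le> b"
    then have y: "v\<^sub>0 \<le> y" "0 < y" using that v0 by auto
    have "((\<lambda>y. (f y)\<^sup>2 / y) has_real_derivative f y * (2 * f' y - f y / y) / y) (at y)"
      using y f_deriv[OF y(2)]
      by (auto intro!: derivative_eq_intros simp: field_simps power2_eq_square)
    moreover have "0 \<le> f y * (2 * f' y - f y / y) / y"
      using *[OF y(1)] y f_pos[OF y(2)] by (intro divide_nonneg_pos mult_nonneg_nonneg) auto
    ultimately show "\<exists>D. ((\<lambda>y. (f y)\<^sup>2 / y) has_real_derivative D) (at y) \<and> 0 \<le> D" by blast
  qed (use that in auto)
  with v0 * show ?thesis by (rule that)
qed

text \<open>Monotonicity of the square of \<open>f\<close> over its argument forces \<open>f\<close>
  to grow at least like a multiple of the square root.\<close>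

lemma f_at_top: "filterlim f at_top at_top"
proof -
  obtain v where v: "1 \<le> v" "\<And>a b. v \<le> a \<Longrightarrow> a \<le> b \<Longrightarrow> (f a)\<^sup>2 / a \<le> (f b)\<^sup>2 / b"
    using eventually_elastic by metis
  have c: "0 < (f v)\<^sup>2 / v" using v f_pos[of v] by simp
  have "filterlim (\<lambda>y. sqrt ((f v)\<^sup>2 / v * y)) at_top at_top"
    by (intro filterlim_compose[OF sqrt_at_top] filterlim_tendsto_pos_mult_at_top[OF tendsto_const c] filterlim_ident)
  then show ?thesis
  proof (rule filterlim_at_top_mono)
    show "\<forall>\<^sub>F y in at_top. sqrt ((f v)\<^sup>2 / v * y) \<le> f y"
      using eventually_ge_at_top[of v]
    proof eventually_elim
      case (elim y)
      have "(f v)\<^sup>2 / v * y \<le> (f y)\<^sup>2" using v(2)[of v y] elim v(1) by (simp add: field_simps)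
      then show ?case using f_pos[of y] elim v(1) by (intro real_le_lsqrt) auto
    qed
  qed
qed

section \<open>The primitive \<open>G\<close> of \<open>f v / v\<close>\<close>

definition G :: "real \<Rightarrow> real" where "G y = (LBINT v=1..y. f v / v)"

lemma G_deriv: "(G has_real_derivative f y / y) (at y)" if "0 < y"
  unfolding G_def using that
  by (intro interval_integral_has_real_derivative continuous_intros f_cont) force+

lemma G_mono: "G a \<le> G b" if "0 < a" "a \<le> b"
proof (rule DERIV_nonneg_imp_nondecreasing[of a b G])
  fix y assume "a \<le> y" "y \<le> b"
  then show "\<exists>D. (G has_real_derivative D) (at y) \<and> 0 \<le> D"
    using that f_pos[of y] G_deriv[of y] by (intro exI[of _ "f y / y"]) auto
qed (use that in auto)

text \<open>The cut-off \<open>max 1\<close> extends the integrand continuously to the whole line,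
  so that it is Borel measurable; on \<open>{a..b}\<close> it changes nothing.\<close>

lemma nn_integral_G:
  assumes "1 \<le> a" "a \<le> b"
  shows "(\<integral>\<^sup>+v. ennreal (f (max 1 v) / max 1 v) * indicator {a..b} v \<partial>lborel) = ennreal (G b - G a)"
proof -
  have "continuous_on UNIV (\<lambda>v. f (max 1 v) / max 1 v)"
    by (intro continuous_intros continuous_on_compose2[OF f_cont]) auto
  then have "(\<lambda>v. f (max 1 v) / max 1 v) \<in> borel_measurable borel"
    by (rule borel_measurable_continuous_onI)
  then show ?thesis
    using assms f_pos
    by (intro nn_integral_FTC_Icc)
     (auto simp: max_def intro!: has_field_derivative_at_within G_deriv divide_nonneg_pos less_imp_le[OF f_pos])
qed

text \<open>Holds because \<open>f' y \<le> f y / y\<close>; it passes the divergence of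
  \<open>f\<close> on to \<open>G\<close>.\<close>

lemma f_diff_le_G_diff: "f b - f a \<le> G b - G a" if "0 < a" "a \<le> b"
proof -
  have "G a - f a \<le> G b - f b"
  proof (rule DERIV_nonneg_imp_nondecreasing[of a b "\<lambda>y. G y - f y"])
    fix y assume "a \<le> y" "y \<le> b"
    then have y: "0 < y" using that by simp
    have "((\<lambda>y. G y - f y) has_real_derivative f y / y - f' y) (at y)"
      using y by (intro derivative_intros G_deriv f_deriv)
    moreover have "0 \<le> f y / y - f' y" using mult_f'_le_f[OF y] y by (simp add: field_simps)
    ultimately show "\<exists>D. ((\<lambda>y. G y - f y) has_real_derivative D) (at y) \<and> 0 \<le> D" by blast
  qed (use that in auto)
  then show ?thesis by simp
qed

lemma G_at_top: "filterlim G at_top at_top"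
proof -
  have "filterlim (\<lambda>y. - f 1 + f y) at_top at_top"
    by (intro filterlim_tendsto_add_at_top[OF tendsto_const] f_at_top)
  moreover have "\<forall>\<^sub>F y in at_top. - f 1 + f y \<le> G y"
    using eventually_ge_at_top[of 1]
  proof eventually_elim
    case (elim y)
    then show ?case using f_diff_le_G_diff[of 1 y] by (simp add: G_def one_ereal_def)
  qed
  ultimately show ?thesis by (rule filterlim_at_top_mono)
qed

lemma G_diff_le_f_diff:
  assumes "0 < a" "a \<le> b" and el: "\<And>v. a \<le> v \<Longrightarrow> f v / v \<le> 2 * f' v"
  shows "G b - G a \<le> 2 * (f b - f a)"
proof -
  have "2 * f a - G a \<le> 2 * f b - G b"
  proof (rule DERIV_nonneg_imp_nondecreasing[of a b "\<lambda>y. 2 * f y - G y"])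
    fix y assume y': "a \<le> y" "y \<le> b"
    then have y: "0 < y" using assms by simp
    have "((\<lambda>y. 2 * f y - G y) has_real_derivative 2 * f' y - f y / y) (at y)"
      using y by (intro derivative_intros DERIV_cmult G_deriv f_deriv)
    then show "\<exists>D. ((\<lambda>y. 2 * f y - G y) has_real_derivative D) (at y) \<and> 0 \<le> D"
      using el[OF y'(1)] by force
  qed (use assms in auto)
  then show ?thesis by simp
qed

text \<open>\<open>G\<close> is a convex function of \<open>F f\<close> where \<open>f\<^sup>2 / v = G' / (F f)'\<close> increases.\<close>

lemma G_diff_halving:
  assumes "0 < q" "q \<le> y" "0 < p" "p \<le> y" and F: "2 * F f p \<le> F f q + F f y"
    and inc: "\<And>a b. q \<le> a \<Longrightarrow> a \<le> b \<Longrightarrow> (f a)\<^sup>2 / a \<le> (f b)\<^sup>2 / b"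
  shows "G y - G q \<le> 2 * (G y - G p)"
proof -
  \<comment> \<open>Only the third case needs convexity. If \<open>p = y\<close>, the hypothesis on
    \<open>F f\<close> forces \<open>q = y\<close> and both sides vanish.\<close>
  consider "p \<le> q" | "p = y" | "q < p" "p < y" using assms by linarith
  then show ?thesis
  proof cases
    case 1
    then show ?thesis using G_mono[of p q] G_mono[of q y] assms by auto
  next
    case 2
    then have "y \<le> q" using F assms F_le_iff[of y q] by auto
    then show ?thesis using assms 2 by auto
  next
    case 3
    \<comment> \<open>Cauchy's mean value theorem for the pair \<open>F f\<close> and
      \<open>G\<close>: the ratio of the derivatives \<open>f z / z\<close> and
      \<open>1 / f z\<close> is the increasing slope.\<close>
    have cauchy: "\<exists>z. a < z \<and> z < b \<and> G b - G a = (f z)\<^sup>2 / z * (F f b - F f a)" if ab: "0 < a" "a < b" for a b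
    proof -
      obtain z where z: "a < z" "z < b" "(F f b - F f a) * (f z / z) = (G b - G a) * (1 / f z)"
        by (rule exE[OF GMVT'[of a b "F f" G "\<lambda>v. f v / v" "\<lambda>v. 1 / f v"]])
          (use ab in \<open>auto intro: DERIV_isCont[OF F_deriv] DERIV_isCont[OF G_deriv] F_deriv G_deriv\<close>)
      moreover have "0 < f z" using z ab f_pos by auto
      ultimately show ?thesis by (intro exI[of _ z]) (auto simp: field_simps power2_eq_square)
    qed
    obtain c where c: "q < c" "c < p" "G p - G q = (f c)\<^sup>2 / c * (F f p - F f q)"
      using cauchy[of q p] assms 3 by blast
    obtain d where d: "p < d" "d < y" "G y - G p = (f d)\<^sup>2 / d * (F f y - F f p)"
      using cauchy[of p y] assms 3 by blast
    have "G p - G q \<le> (f d)\<^sup>2 / d * (F f p - F f q)"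
      unfolding c(3) using c d assms F_strict_mono[of q p] 3
      by (intro mult_right_mono inc) auto
    also have "\<dots> \<le> G y - G p"
      unfolding d(3) using F d assms by (intro mult_left_mono) auto
    finally show ?thesis by simp
  qed
qed

end

subsection \<open>The delay equation\<close>

text \<open>Here \<open>\<nu>\<close> lives on the whole line and charges no negative lags, so that
  measurability arguments avoid restricted spaces; the half-line measure enters later through its
  image.\<close>

locale delay_equation = sublinear_growth f f' + finite_measure \<nu>
  for f f' :: "real \<Rightarrow> real" and \<nu> :: "real measure" +
  fixes x :: "real \<Rightarrow> real" and \<psi> :: real
  assumes sets_\<nu> [measurable_cong]: "sets \<nu> = sets borel"
    and \<nu>_nonneg: "AE s in \<nu>. 0 \<le> s"
    and M_pos: "0 < measure \<nu> UNIV"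
    and x_cont: "continuous_on {0..} x"
    and x_pos: "\<And>t. 0 \<le> t \<Longrightarrow> 0 < x t"
    and x_eq: "\<And>t. 0 \<le> t \<Longrightarrow>
      x t = \<psi> + (LBINT u:{0..t}. (LINT s:{0..u}|\<nu>. f (x (u - s))))"
begin

abbreviation M :: real where "M \<equiv> measure \<nu> UNIV"

text \<open>\<open>X\<close> freezes the solution at \<open>\<psi>\<close> before time \<open>0\<close>, and \<open>B\<close> bounds from below the amount by which the delay
  keeps \<open>x' / f x\<close> short of \<open>M\<close>.\<close>

definition X :: "real \<Rightarrow> real" where "X t = x (max 0 t)"

definition e :: "real \<Rightarrow> real" where "e t = f (X t)"

definition w :: "real \<Rightarrow> real" where "w u = (LINT s:{0..u}|\<nu>. e (u - s))"

definition B :: "real \<Rightarrow> real" where "B u = (LINT s|\<nu>. 1 - e (u - s) / e u)"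

lemma space_\<nu> [simp]: "space \<nu> = UNIV"
  using sets_eq_imp_space_eq[OF sets_\<nu>] by simp

lemma emeasure_\<nu>: "emeasure \<nu> UNIV = ennreal M"
  using emeasure_eq_measure[of UNIV] by simp

lemma X_eq [simp]: "0 \<le> t \<Longrightarrow> X t = x t"
  by (simp add: X_def)

lemma X_pos: "0 < X t"
  by (simp add: X_def x_pos)

lemma X_cont: "continuous_on UNIV X"
  unfolding X_def by (intro continuous_on_compose2[OF x_cont] continuous_intros) auto

lemma X_measurable [measurable]: "X \<in> borel_measurable borel"
  by (intro borel_measurable_continuous_onI X_cont)

lemma e_cont: "continuous_on UNIV e"
  unfolding e_def using X_pos by (intro continuous_on_compose2[OF f_cont X_cont]) auto

lemma e_measurable [measurable]: "e \<in> borel_measurable borel"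
  by (intro borel_measurable_continuous_onI e_cont)

lemma e_pos: "0 < e t"
  by (simp add: e_def f_pos X_pos)

lemma x_0: "x 0 = \<psi>"
proof -
  have "(LBINT u:{0..0::real}. (LINT s:{0..u}|\<nu>. f (x (u - s)))) = 0"
    unfolding set_lebesgue_integral_def
    by (intro integral_eq_zero_AE eventually_mono[OF AE_lborel_singleton[of 0]]) auto
  then show ?thesis using x_eq[of 0] by simp
qed

lemma x_eq_w: "x t = \<psi> + (LBINT u:{0..t}. w u)" if "0 \<le> t"
proof -
  have "(LINT s:{0..u}|\<nu>. f (x (u - s))) = w u" for u
    unfolding w_def by (intro set_lebesgue_integral_cong) (auto simp: e_def sets_\<nu>)
  then show ?thesis using x_eq[OF that] by simp
qed

lemma w_nonneg: "0 \<le> w u"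
  unfolding w_def set_lebesgue_integral_def
  by (intro integral_nonneg_AE AE_I2) (auto simp: indicator_def less_imp_le[OF e_pos])

lemma w_measurable [measurable]: "w \<in> borel_measurable borel"
proof -
  have "w = (\<lambda>u. LINT s|\<nu>. (if 0 \<le> s \<and> s \<le> u then e (u - s) else 0))"
    by (auto simp: w_def set_lebesgue_integral_def fun_eq_iff indicator_def intro!: Bochner_Integration.integral_cong)
  also have "\<dots> \<in> borel_measurable borel"
    by measurable
  finally show ?thesis .
qed

lemma w_le:
  assumes "\<And>v. 0 \<le> v \<Longrightarrow> v \<le> u \<Longrightarrow> e v \<le> C" "0 \<le> C"
  shows "w u \<le> C * M"
  unfolding w_def set_lebesgue_integral_def
proof (rule integral_real_bounded)
  have "(\<integral>\<^sup>+s. ennreal (indicat_real {0..u} s *\<^sub>R e (u - s)) \<partial>\<nu>) \<le> (\<integral>\<^sup>+s. ennreal C \<partial>\<nu>)"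
    using assms by (intro nn_integral_mono ennreal_leI) (auto simp: indicator_def)
  also have "\<dots> = ennreal (C * M)"
    using assms by (simp add: emeasure_\<nu> ennreal_mult)
  finally show "(\<integral>\<^sup>+s. ennreal (indicat_real {0..u} s *\<^sub>R e (u - s)) \<partial>\<nu>) \<le> ennreal (C * M)" .
qed (use assms M_pos in auto)

text \<open>Continuity bounds \<open>e\<close>, and with it \<open>w\<close>, on
  \<open>{0..t}\<close>. Integrability is what allows the integral defining \<open>x\<close> to be
  split at an intermediate time.\<close>

lemma w_integrable: "set_integrable lborel {0..t} w"
proof -
  have "compact (e ` {0..t})"
    by (intro compact_continuous_image continuous_on_subset[OF e_cont]) auto
  then have "bounded (e ` {0..t})" by (rule compact_imp_bounded)
  then obtain C where C: "\<And>v. 0 \<le> v \<Longrightarrow> v \<le> t \<Longrightarrow> \<bar>e v\<bar> \<le> C"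
    unfolding bounded_iff by (metis atLeastAtMost_iff imageI real_norm_def)
  have *: "w u \<le> max 0 C * M" if "u \<le> t" for u
  proof (rule w_le)
    fix v assume "0 \<le> v" "v \<le> u"
    then show "e v \<le> max 0 C" using C[of v] that by linarith
  qed simp
  show ?thesis unfolding set_integrable_def
  proof (rule integrableI_bounded_set_indicator[where B = "max 0 C * M"])
    show "AE u in lborel. u \<in> {0..t} \<longrightarrow> norm (w u) \<le> max 0 C * M"
      using * w_nonneg by auto
  qed (auto simp: emeasure_lborel_Icc_eq)
qed

lemma x_diff: "x t - x r = (LBINT u:{r<..t}. w u)" if "0 \<le> r" "r \<le> t"
proof -
  have "(LBINT u:{0..r} \<union> {r<..t}. w u) = (LBINT u:{0..r}. w u) + (LBINT u:{r<..t}. w u)"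
    using that by (intro set_integral_Un set_integrable_subset[OF w_integrable[of t]]) auto
  moreover have "{0..r} \<union> {r<..t} = {0..t}" using that by auto
  ultimately show ?thesis
    using x_eq_w[of t] x_eq_w[of r] that by simp
qed

lemma nn_integral_w:
  assumes "0 \<le> r" "r \<le> t"
  shows "(\<integral>\<^sup>+u. ennreal (w u) * indicator {r..t} u \<partial>lborel) = ennreal (x t - x r)"
proof -
  have "set_integrable lborel {r<..t} w"
    using assms by (intro set_integrable_subset[OF w_integrable[of t]]) auto
  then have "(\<integral>\<^sup>+u. ennreal (indicat_real {r<..t} u *\<^sub>R w u) \<partial>lborel) = ennreal (LBINT u:{r<..t}. w u)"
    unfolding set_lebesgue_integral_def set_integrable_def
    using w_nonneg by (intro nn_integral_eq_integral) auto
  moreover have "(\<integral>\<^sup>+u. ennreal (w u) * indicator {r..t} u \<partial>lborel) = (\<integral>\<^sup>+u. ennreal (indicat_real {r<..t} u *\<^sub>R w u) \<partial>lborel)"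
    using AE_lborel_singleton[of r] by (intro nn_integral_cong_AE) (auto elim!: eventually_mono simp: indicator_def)
  ultimately show ?thesis using x_diff[OF assms] by simp
qed

lemma x_mono: "x r \<le> x t" if "0 \<le> r" "r \<le> t"
proof -
  have "0 \<le> (LBINT u:{r<..t}. w u)"
    unfolding set_lebesgue_integral_def using w_nonneg by (intro integral_nonneg_AE AE_I2) auto
  then show ?thesis using x_diff[OF that] by simp
qed

lemma X_mono: "X r \<le> X t" if "r \<le> t"
  using that unfolding X_def by (intro x_mono) auto

lemma e_mono: "e r \<le> e t" if "r \<le> t"
  unfolding e_def using that by (intro f_mono X_pos X_mono)

text \<open>Since \<open>x\<close> is monotone with density \<open>w\<close>, it transports \<open>w du\<close> on \<open>[r, t]\<close> to Lebesgue measure on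
  \<open>[x r, x t]\<close>. This replaces a chain rule, as \<open>x\<close> need not be differentiable everywhere.\<close>

lemma nn_integral_substitution:
  assumes rt: "0 \<le> r" "r \<le> t" and k [measurable]: "k \<in> borel_measurable borel"
  shows "(\<integral>\<^sup>+y. k y * indicator {x r..x t} y \<partial>lborel) =
         (\<integral>\<^sup>+u. k (X u) * ennreal (w u) * indicator {r..t} u \<partial>lborel)"
proof -
  \<comment> \<open>\<open>N1\<close> is the image under \<open>X\<close> of \<open>w du\<close> on
    \<open>[r, t]\<close>, and \<open>N2\<close> is Lebesgue measure on \<open>[x r, x t]\<close>;
    they are compared on the half-lines \<open>{a<..}\<close>.\<close>
  define N1 where "N1 = distr (density lborel (\<lambda>u. ennreal (w u) * indicator {r..t} u)) borel X"
  define N2 where "N2 = density lborel (indicator {x r..x t})"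
  have N1: "emeasure N1 {a<..} = (\<integral>\<^sup>+u. ennreal (w u) * indicator {u\<in>{r..t}. a < X u} u \<partial>lborel)" for a
  proof -
    have "emeasure N1 {a<..} = emeasure (density lborel (\<lambda>u. ennreal (w u) * indicator {r..t} u)) (X -` {a<..})"
      unfolding N1_def by (subst emeasure_distr) auto
    also have "\<dots> = (\<integral>\<^sup>+u. ennreal (w u) * indicator {r..t} u * indicator (X -` {a<..}) u \<partial>lborel)"
      by (intro emeasure_density) (auto intro!: measurable_sets_borel[of X borel])
    also have "\<dots> = (\<integral>\<^sup>+u. ennreal (w u) * indicator {u\<in>{r..t}. a < X u} u \<partial>lborel)"
      by (intro nn_integral_cong) (auto simp: indicator_def)
    finally show ?thesis .
  qed
  have N2: "emeasure N2 {a<..} = emeasure lborel ({x r..x t} \<inter> {a<..})" for a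
  proof -
    have "emeasure N2 {a<..} = (\<integral>\<^sup>+y. indicator {x r..x t} y * indicator {a<..} y \<partial>lborel)"
      unfolding N2_def by (subst emeasure_density) auto
    also have "\<dots> = (\<integral>\<^sup>+y. indicator ({x r..x t} \<inter> {a<..}) y \<partial>lborel)"
      by (intro nn_integral_cong) (auto simp: indicator_def)
    finally show ?thesis by simp
  qed
  have eq: "emeasure N1 {a<..} = emeasure N2 {a<..}" for a
  proof -
    consider "x t \<le> a" | "a < x r" | "x r \<le> a" "a < x t" by linarith
    then show ?thesis
    proof cases
      case 1
      then have "{u\<in>{r..t}. a < X u} = {}" "{x r..x t} \<inter> {a<..} = {}"
        using rt x_mono by (auto simp: not_less) (meson order.trans x_mono)
      then show ?thesis by (simp add: N1 N2)
    next
      case 2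
      then have "{u\<in>{r..t}. a < X u} = {r..t}" "{x r..x t} \<inter> {a<..} = {x r..x t}"
        using rt by (auto intro: less_le_trans[OF _ x_mono])
      then show ?thesis using x_mono[OF rt] by (simp only: N1 N2 nn_integral_w[OF rt]) simp
    next
      case 3
      \<comment> \<open>The solution may pause at level \<open>a\<close>, so \<open>c\<close> is
        taken as the last time in \<open>[r, t]\<close> at which \<open>X\<close> is at most
        \<open>a\<close>; compactness of \<open>A\<close> provides it, and the intermediate value
        theorem gives \<open>X c = a\<close>.\<close>
      define A where "A = {u\<in>{r..t}. X u \<le> a}"
      have "A = {r..t} \<inter> {u. X u \<le> a}" by (auto simp: A_def)
      also have "compact \<dots>"
        by (intro compact_Int_closed closed_Collect_le X_cont continuous_on_const) auto
      finally have "compact A" .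
      moreover have "r \<in> A" using rt 3 by (auto simp: A_def)
      ultimately obtain c where c: "c \<in> A" "\<And>u. u \<in> A \<Longrightarrow> u \<le> c"
        using compact_attains_sup[of A] by blast
      obtain c' where c': "r \<le> c'" "c' \<le> t" "X c' = a"
        using IVT'[of X r a t] 3 rt continuous_on_subset[OF X_cont] by auto
      have "X c' \<le> X c" using c(2)[of c'] c' by (intro X_mono) (auto simp: A_def)
      with c c' have Xc: "X c = a" "r \<le> c" "c \<le> t" by (auto simp: A_def)
      have "{u\<in>{r..t}. a < X u} = {c<..t}"
      proof (intro equalityI subsetI)
        fix u assume "u \<in> {u\<in>{r..t}. a < X u}"
        then show "u \<in> {c<..t}" using X_mono[of u c] Xc by (cases "u \<le> c") auto
      next
        fix u assume "u \<in> {c<..t}"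
        then show "u \<in> {u\<in>{r..t}. a < X u}" using c(2)[of u] Xc by (cases "X u \<le> a") (auto simp: A_def)
      qed
      then have "emeasure N1 {a<..} = (\<integral>\<^sup>+u. ennreal (w u) * indicator {c<..t} u \<partial>lborel)"
        by (simp add: N1)
      also have "\<dots> = (\<integral>\<^sup>+u. ennreal (w u) * indicator {c..t} u \<partial>lborel)"
        using AE_lborel_singleton[of c] by (intro nn_integral_cong_AE) (auto elim!: eventually_mono simp: indicator_def)
      also have "\<dots> = ennreal (x t - a)"
        using nn_integral_w[of c t] Xc rt by simp
      also have "\<dots> = emeasure lborel {a<..x t}" using 3 by simp
      also have "{a<..x t} = {x r..x t} \<inter> {a<..}" using 3 by auto
      finally show ?thesis by (simp add: N2)
    qed
  qed
  \<comment> \<open>Open upper half-lines determine a Borel measure that is finite on them.\<close>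
  have "N1 = N2"
  proof (rule measure_eqI_lessThan)
    show "emeasure N1 {a<..} < \<infinity>" for a
    proof -
      have "emeasure N1 {a<..} \<le> emeasure lborel {x r..x t}"
        unfolding eq N2 by (intro emeasure_mono) auto
      also have "\<dots> < \<infinity>" by (simp add: emeasure_lborel_Icc_eq)
      finally show ?thesis .
    qed
  qed (use eq in \<open>auto simp: N1_def N2_def\<close>)
  have "(\<integral>\<^sup>+y. k y * indicator {x r..x t} y \<partial>lborel) = (\<integral>\<^sup>+y. k y \<partial>N2)"
    unfolding N2_def by (subst nn_integral_density) (auto simp: mult.commute)
  also have "\<dots> = (\<integral>\<^sup>+y. k y \<partial>N1)" by (simp add: \<open>N1 = N2\<close>)
  also have "\<dots> = (\<integral>\<^sup>+u. ennreal (w u) * indicator {r..t} u * k (X u) \<partial>lborel)"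
    unfolding N1_def by (subst nn_integral_distr) (auto simp: nn_integral_density)
  finally show ?thesis by (simp add: mult_ac)
qed

text \<open>The integrated chain rule for \<open>F f\<close> along \<open>x\<close>, obtained by
  substituting into the integral of \<open>1 / f\<close>; the cut-off at \<open>x r\<close> makes
  that integrand Borel on the whole line.\<close>

lemma nn_integral_w_over_e:
  assumes rt: "0 \<le> r" "r \<le> t"
  shows "(\<integral>\<^sup>+u. ennreal (w u / e u) * indicator {r..t} u \<partial>lborel) = ennreal (F f (x t) - F f (x r))"
proof -
  define k where "k y = 1 / f (max (x r) y)" for y
  have xr: "0 < x r" using rt x_pos by simp
  have "continuous_on UNIV k"
    unfolding k_def using xr
    by (intro continuous_intros continuous_on_compose2[OF f_cont] ballI less_imp_neq[symmetric] f_pos) auto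
  then have km [measurable]: "k \<in> borel_measurable borel"
    by (rule borel_measurable_continuous_onI)
  have k_eq: "k y = 1 / f y" if "x r \<le> y" for y
    using that by (simp add: k_def max_def)
  have kX: "k (X u) * w u = w u / e u" if "r \<le> u" for u
    using x_mono[of r u] that rt by (simp add: k_def e_def max_def)
  have k_nonneg: "0 \<le> k y" for y
    unfolding k_def using f_pos[of "max (x r) y"] xr by (auto simp: max_def)
  have "ennreal (F f (x t) - F f (x r)) = (\<integral>\<^sup>+y. ennreal (k y) * indicator {x r..x t} y \<partial>lborel)"
    using xr x_mono[OF rt] k_nonneg
    by (intro nn_integral_FTC_Icc[symmetric])
      (auto simp: k_eq intro!: has_field_derivative_at_within F_deriv less_imp_le[OF f_pos])
  also have "\<dots> = (\<integral>\<^sup>+u. ennreal (k (X u)) * ennreal (w u) * indicator {r..t} u \<partial>lborel)"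
    by (rule nn_integral_substitution[OF rt]) auto
  also have "\<dots> = (\<integral>\<^sup>+u. ennreal (w u / e u) * indicator {r..t} u \<partial>lborel)"
    by (intro nn_integral_cong) (auto simp: indicator_def kX ennreal_mult[symmetric] k_nonneg w_nonneg)
  finally show ?thesis ..
qed

section \<open>The delay loss and the speed of the solution\<close>

lemma integrable_e_diff: "integrable \<nu> (\<lambda>s. e (u - s))"
  using \<nu>_nonneg
  by (intro integrable_const_bound[of _ "e u"])
    (auto elim!: eventually_mono simp: abs_of_pos[OF e_pos] intro!: e_mono)

lemma B_eq: "B u = M - (LINT s|\<nu>. e (u - s)) / e u"
  unfolding B_def using integrable_e_diff[of u] by (subst Bochner_Integration.integral_diff) auto

lemma w_le_B: "w u \<le> e u * (M - B u)"
proof -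
  have "w u \<le> (LINT s|\<nu>. e (u - s))"
    unfolding w_def set_lebesgue_integral_def
    by (intro integral_mono integrable_e_diff integrable_mult_indicator[of "{0..u}"])
      (auto simp: indicator_def sets_\<nu> less_imp_le[OF e_pos])
  then show ?thesis using e_pos[of u] by (simp add: B_eq)
qed

lemma B_nonneg: "0 \<le> B u"
  unfolding B_def using \<nu>_nonneg e_pos
  by (intro integral_nonneg_AE) (auto elim!: eventually_mono simp: divide_le_eq_1 intro: e_mono)

lemma w_le_M: "w u \<le> e u * M"
proof -
  have "e u * (M - B u) \<le> e u * M"
    using B_nonneg[of u] e_pos[of u] by (intro mult_left_mono) auto
  then show ?thesis using w_le_B[of u] by linarith
qed

lemma B_measurable [measurable]: "B \<in> borel_measurable borel"
  unfolding B_def by measurable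

text \<open>Integrates \<open>B u + w u / e u \<le> M\<close> over \<open>[r, t]\<close> and
  evaluates the second summand as an increment of \<open>F f\<close>, which is finite and can be
  subtracted.\<close>

lemma nn_integral_B_le:
  assumes rt: "0 \<le> r" "r \<le> t"
  shows "(\<integral>\<^sup>+u. ennreal (B u) * indicator {r..t} u \<partial>lborel)
     \<le> ennreal (M * (t - r) - (F f (x t) - F f (x r)))"
proof -
  have F: "0 \<le> F f (x t) - F f (x r)"
    using x_mono[OF rt] x_pos rt by (simp add: F_le_iff)
  have "(\<integral>\<^sup>+u. ennreal (B u) * indicator {r..t} u \<partial>lborel) + ennreal (F f (x t) - F f (x r))
      = (\<integral>\<^sup>+u. ennreal (B u) * indicator {r..t} u + ennreal (w u / e u) * indicator {r..t} u \<partial>lborel)"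
    unfolding nn_integral_w_over_e[OF rt, symmetric] by (intro nn_integral_add[symmetric]) auto
  also have "\<dots> \<le> (\<integral>\<^sup>+u. ennreal M * indicator {r..t} u \<partial>lborel)"
  proof (intro nn_integral_mono)
    fix u
    have "B u + w u / e u \<le> M" using w_le_B[of u] e_pos[of u] by (simp add: field_simps)
    moreover have "0 \<le> w u / e u" using w_nonneg[of u] e_pos[of u] by simp
    ultimately have "ennreal (B u) + ennreal (w u / e u) \<le> ennreal M"
      using B_nonneg[of u] by (simp only: ennreal_plus[symmetric] ennreal_leI)
    then show "ennreal (B u) * indicator {r..t} u + ennreal (w u / e u) * indicator {r..t} u
      \<le> ennreal M * indicator {r..t} u"
      by (auto simp: indicator_def)
  qed
  also have "\<dots> = ennreal (M * (t - r))"
    using rt by (simp add: nn_integral_cmult_indicator ennreal_mult)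
  finally have "(\<integral>\<^sup>+u. ennreal (B u) * indicator {r..t} u \<partial>lborel) \<le> ennreal (M * (t - r)) - ennreal (F f (x t) - F f (x r))"
    by (intro ennreal_le_minus_iff[THEN iffD2] disjI1) auto
  then show ?thesis using F by (simp add: ennreal_minus)
qed

lemma F_increment_le: "F f (x t) - F f (x r) \<le> M * (t - r)" if rt: "0 \<le> r" "r \<le> t"
proof -
  have "ennreal (F f (x t) - F f (x r)) \<le> (\<integral>\<^sup>+u. ennreal M * indicator {r..t} u \<partial>lborel)"
    unfolding nn_integral_w_over_e[OF rt, symmetric]
    using w_le_M e_pos by (intro nn_integral_mono mult_right_mono ennreal_leI) (auto simp: pos_divide_le_eq mult.commute)
  also have "\<dots> = ennreal (M * (t - r))"
    using rt by (simp add: nn_integral_cmult_indicator ennreal_mult)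
  finally show ?thesis using rt by (simp add: ennreal_le_iff)
qed

text \<open>Lags in some \<open>{0..S}\<close> carry more than \<open>3/4\<close> of the mass, and
  for large \<open>u\<close> the value of \<open>e\<close> at time \<open>u - S\<close> is still at
  least \<open>2/3\<close> of \<open>e u\<close>. The product of the two fractions is
  \<open>1/2\<close>.\<close>

lemma eventually_w_ge:
  assumes x: "filterlim x at_top at_top"
  shows "\<forall>\<^sub>F u in at_top. M / 2 * e u \<le> w u"
proof -
  have "(\<lambda>n. measure \<nu> {..real n}) \<longlonglongrightarrow> measure \<nu> (\<Union>n. {..real n})"
    by (intro finite_Lim_measure_incseq) (auto simp: sets_\<nu> incseq_def)
  moreover have "(\<Union>n. {..real n}) = UNIV" using real_arch_simple by auto
  ultimately have "\<forall>\<^sub>F n in sequentially. 3/4 * M < measure \<nu> {..real n}"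
    using M_pos by (intro order_tendstoD(1)[of _ M]) auto
  then obtain n where n: "3/4 * M < measure \<nu> {..real n}"
    by (auto simp: eventually_sequentially)
  define S where "S = real n"
  have S: "0 \<le> S" "3/4 * M < measure \<nu> {0..S}"
  proof -
    have "measure \<nu> {0..S} = measure \<nu> {..S}"
      using \<nu>_nonneg by (intro finite_measure_eq_AE) (auto simp: sets_\<nu> elim!: eventually_mono)
    then show "0 \<le> S" "3/4 * M < measure \<nu> {0..S}" using n by (auto simp: S_def)
  qed
  have "\<forall>\<^sub>F y in at_top. f y / y < 1 / (3 * M * (S + 1))"
    using M_pos S by (intro order_tendstoD(2)[OF ratio_tendsto_0]) auto
  then have "\<forall>\<^sub>F u in at_top. f (x u) / x u < 1 / (3 * M * (S + 1))"
    using x by (rule eventually_compose_filterlim)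
  then show ?thesis using eventually_ge_at_top[of S]
  proof eventually_elim
    case (elim u)
    \<comment> \<open>Over a time span \<open>S\<close> the solution gains at most
      \<open>M * S * f b\<close>, which the choice of \<open>u\<close> keeps below
      \<open>b / 3\<close>; as \<open>f y / y\<close> decreases, \<open>a \<ge> 2/3 * b\<close>
      carries over to the values of \<open>f\<close>. Using \<open>S + 1\<close> covers
      \<open>S = 0\<close>.\<close>
    define a b where "a = x (u - S)" and "b = x u"
    have ab: "0 < a" "a \<le> b" "0 < b" using elim S by (auto simp: a_def b_def intro!: x_pos x_mono)
    have "(b - a) / f b \<le> M * S"
      using F_diff_ge[of a b] F_increment_le[of "u - S" u] elim S ab by (simp add: a_def b_def)
    then have "b - a \<le> M * S * f b" using f_pos[of b] ab by (simp add: field_simps)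
    also have "\<dots> \<le> M * (S + 1) * f b" using f_pos[of b] ab M_pos by (intro mult_right_mono) auto
    also have "\<dots> \<le> b / 3"
    proof -
      have "0 < 3 * M * (S + 1)" using S M_pos by simp
      then show ?thesis using elim(1) ab by (simp add: b_def[symmetric] pos_less_divide_eq pos_divide_less_eq mult_ac)
    qed
    finally have a: "2/3 * b \<le> a" by simp
    have "2/3 * f b \<le> a / b * f b" using a ab f_pos[of b] by (intro mult_right_mono) (auto simp: field_simps)
    also have "\<dots> \<le> f a" using ratio_antimono[of a b] ab by (simp add: field_simps)
    finally have ea: "2/3 * e u \<le> e (u - S)" using elim S by (simp add: e_def a_def b_def)
    have "M / 2 * e u = 3/4 * M * (2/3 * e u)" by simp
    also have "\<dots> \<le> measure \<nu> {0..S} * e (u - S)"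
      using S M_pos e_pos[of u] ea by (intro mult_mono) auto
    also have "\<dots> = (LINT s|\<nu>. indicator {0..S} s * e (u - S))"
      by (simp add: sets_\<nu>)
    also have "\<dots> \<le> w u"
      unfolding w_def set_lebesgue_integral_def
    proof (intro integral_mono)
      show "integrable \<nu> (\<lambda>s. indicat_real {0..S} s * e (u - S))"
        by (intro integrable_mult_left integrable_real_indicator) (auto simp: sets_\<nu> less_top[symmetric])
      show "integrable \<nu> (\<lambda>s. indicat_real {0..u} s *\<^sub>R e (u - s))"
        by (intro integrable_mult_indicator integrable_e_diff) (auto simp: sets_\<nu>)
      show "indicat_real {0..S} s * e (u - S) \<le> indicat_real {0..u} s *\<^sub>R e (u - s)" for s
        using elim less_imp_le[OF e_pos] by (auto simp: indicator_def intro!: e_mono)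
    qed
    finally show ?case .
  qed
qed

lemma F_increment_ge:
  assumes x: "filterlim x at_top at_top"
  obtains T where "0 \<le> T" "\<And>r t. T \<le> r \<Longrightarrow> r \<le> t \<Longrightarrow> M / 2 * (t - r) \<le> F f (x t) - F f (x r)"
proof -
  obtain T where T: "\<And>u. T \<le> u \<Longrightarrow> M / 2 * e u \<le> w u"
    using eventually_w_ge[OF x] by (auto simp: eventually_at_top_linorder)
  have "M / 2 * (t - r) \<le> F f (x t) - F f (x r)" if "max 0 T \<le> r" "r \<le> t" for r t
  proof -
    have rt: "0 \<le> r" "r \<le> t" using that by auto
    have "ennreal (M / 2 * (t - r)) = (\<integral>\<^sup>+u. ennreal (M / 2) * indicator {r..t} u \<partial>lborel)"
      using rt M_pos by (subst nn_integral_cmult_indicator) (auto simp del: times_divide_eq_left simp: ennreal_mult)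
    also have "\<dots> \<le> (\<integral>\<^sup>+u. ennreal (w u / e u) * indicator {r..t} u \<partial>lborel)"
    proof (intro nn_integral_mono)
      fix u
      show "ennreal (M / 2) * indicator {r..t} u \<le> ennreal (w u / e u) * indicator {r..t} u"
        using T[of u] e_pos[of u] that by (auto simp: indicator_def field_simps intro!: ennreal_leI)
    qed
    also have "\<dots> = ennreal (F f (x t) - F f (x r))" by (rule nn_integral_w_over_e[OF rt])
    finally show ?thesis
      using x_mono[OF rt] x_pos rt F_le_iff[of "x r" "x t"] by (simp add: ennreal_le_iff)
  qed
  then show ?thesis by (intro that[of "max 0 T"]) auto
qed

end

subsection \<open>Bounding the kernel by the delay loss\<close>

text \<open>Needs no integrability: the bound is trivial when the right-hand side is infinite. This
  spares checking measurability of the integrand of \<open>K\<^sub>\<nu>\<close>.\<close>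

lemma ennreal_integral_le_nn_integral:
  "ennreal (integral\<^sup>L N g) \<le> (\<integral>\<^sup>+y. ennreal (g y) \<partial>N)"
proof (cases "\<integral>\<^sup>+y. ennreal (g y) \<partial>N")
  case (real c)
  then show ?thesis using integral_real_bounded[of c N g] by (auto intro: ennreal_leI)
qed auto

context delay_equation begin

text \<open>The counterpart of \<open>K\<close> for \<open>\<nu>\<close>; for
  \<open>1 \<le> v \<le> y\<close> the lag window lies in the nonnegative half-line, so the two
  agree in the end.\<close>

definition K\<^sub>\<nu> :: "real \<Rightarrow> real" where
  "K\<^sub>\<nu> y = (LBINT v:{1..y}. f v / v * measure \<nu> {F f y / M - F f v / M..F f y / M})"

text \<open>A majorant of \<open>K\<^sub>\<nu>\<close> that is measurable and in which the integration over the lags \<open>s\<close> can be made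
  the outer one.\<close>

definition K_hat :: "real \<Rightarrow> ennreal" where
  "K_hat y = (\<integral>\<^sup>+v. \<integral>\<^sup>+s. ennreal (f (max 1 v) / max 1 v) *
     (if 1 \<le> v \<and> v \<le> y \<and> F f (max 1 y) - F f (max 1 v) \<le> M * s then 1 else 0) \<partial>\<nu> \<partial>lborel)"

lemma measurable_max_1 [measurable]:
  "(\<lambda>v. f (max 1 v)) \<in> borel_measurable borel" "(\<lambda>v. F f (max 1 v)) \<in> borel_measurable borel"
  by (intro borel_measurable_continuous_onI continuous_on_compose2[OF f_cont]
      continuous_on_compose2[OF F_cont] continuous_intros; auto)+

lemma K_hat_measurable [measurable]: "K_hat \<in> borel_measurable borel"
  unfolding K_hat_def by measurable

text \<open>\<open>K_hat\<close> keeps only the lower end of the lag window, in the form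
  \<open>F f y - F f v \<le> M * s\<close>.\<close>

lemma K_le_K_hat: "ennreal (K\<^sub>\<nu> y) \<le> K_hat y" if y: "1 \<le> y"
proof -
  have "ennreal (K\<^sub>\<nu> y) \<le> (\<integral>\<^sup>+v. ennreal (indicat_real {1..y} v *\<^sub>R
      (f v / v * measure \<nu> {F f y / M - F f v / M..F f y / M})) \<partial>lborel)"
    unfolding K\<^sub>\<nu>_def set_lebesgue_integral_def by (rule ennreal_integral_le_nn_integral)
  also have "\<dots> \<le> K_hat y"
    unfolding K_hat_def
  proof (intro nn_integral_mono)
    fix v :: real
    let ?S = "{F f y / M - F f v / M..F f y / M}"
    show "ennreal (indicat_real {1..y} v *\<^sub>R (f v / v * measure \<nu> ?S)) \<le>
      (\<integral>\<^sup>+s. ennreal (f (max 1 v) / max 1 v) *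
        (if 1 \<le> v \<and> v \<le> y \<and> F f (max 1 y) - F f (max 1 v) \<le> M * s then 1 else 0) \<partial>\<nu>)"
    proof (cases "v \<in> {1..y}")
      case True
      then have "ennreal (indicat_real {1..y} v *\<^sub>R (f v / v * measure \<nu> ?S)) = ennreal (f v / v) * emeasure \<nu> ?S"
        using f_pos[of v] by (simp add: emeasure_eq_measure ennreal_mult[symmetric])
      also have "\<dots> = (\<integral>\<^sup>+s. ennreal (f v / v) * indicator ?S s \<partial>\<nu>)"
        by (simp add: nn_integral_cmult_indicator sets_\<nu>)
      also have "\<dots> \<le> (\<integral>\<^sup>+s. ennreal (f (max 1 v) / max 1 v) *
        (if 1 \<le> v \<and> v \<le> y \<and> F f (max 1 y) - F f (max 1 v) \<le> M * s then 1 else 0) \<partial>\<nu>)"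
        using True y M_pos
        by (intro nn_integral_mono) (auto simp: indicator_def max_def field_simps)
      finally show ?thesis .
    qed simp
  qed
  finally show ?thesis .
qed

lemma K_nonneg: "0 \<le> K\<^sub>\<nu> y"
  unfolding K\<^sub>\<nu>_def set_lebesgue_integral_def
  by (intro integral_nonneg_AE AE_I2) (auto simp: indicator_def less_imp_le[OF f_pos])

text \<open>The crude bounds \<open>f v / v \<le> f 1\<close> and mass at most \<open>M\<close>
  suffice on a bounded initial range, where no comparison with \<open>B\<close> is
  available.\<close>

lemma K_bounded: "K\<^sub>\<nu> y \<le> f 1 * M * (b - 1)" if "1 \<le> y" "y \<le> b"
  unfolding K\<^sub>\<nu>_def set_lebesgue_integral_def
proof (rule integral_real_bounded)
  have "(\<integral>\<^sup>+v. ennreal (indicat_real {1..y} v *\<^sub>R (f v / v * measure \<nu> {F f y / M - F f v / M..F f y / M})) \<partial>lborel)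
    \<le> (\<integral>\<^sup>+v. ennreal (f 1 * M) * indicator {1..b} v \<partial>lborel)"
  proof (intro nn_integral_mono)
    fix v
    have "f v / v * measure \<nu> A \<le> f 1 * M" if "1 \<le> v" for A
      using ratio_antimono[of 1 v] f_pos[of v] f_pos[of 1] that bounded_measure[of A] by (intro mult_mono) auto
    then show "ennreal (indicat_real {1..y} v *\<^sub>R (f v / v * measure \<nu> {F f y / M - F f v / M..F f y / M}))
      \<le> ennreal (f 1 * M) * indicator {1..b} v"
      using that by (auto simp: indicator_def intro!: ennreal_leI)
  qed
  also have "\<dots> = ennreal (f 1 * M * (b - 1))"
    using that M_pos f_pos[of 1] by (simp add: nn_integral_cmult_indicator ennreal_mult)
  finally show "(\<integral>\<^sup>+v. ennreal (indicat_real {1..y} v *\<^sub>R (f v / v * measure \<nu> {F f y / M - F f v / M..F f y / M})) \<partial>lborel)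
    \<le> ennreal (f 1 * M * (b - 1))" .
qed (use that M_pos f_pos[of 1] in auto)

lemma G_1 [simp]: "G 1 = 0"
  by (simp add: G_def one_ereal_def)

text \<open>Both halvings of increments happen here: the solution moves at least at half the speed of the
  flow \<open>y' = M f(y)\<close>, and halving a lag costs at most a factor \<open>2\<close> in \<open>G\<close> by convexity.\<close>

lemma lag_estimate:
  assumes x: "filterlim x at_top at_top"
  obtains T where "0 \<le> T" "1 \<le> x T"
    "\<And>u s. T \<le> u \<Longrightarrow> 0 \<le> s \<Longrightarrow>
      (\<integral>\<^sup>+v. ennreal (f (max 1 v) / max 1 v) *
        (if 1 \<le> v \<and> v \<le> x u \<and> F f (max 1 (x u)) - F f (max 1 v) \<le> M * s then 1 else 0) \<partial>lborel)
      \<le> ennreal (8 * (e u - e (u - s)))"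
proof -
  obtain v\<^sub>0 where v0: "1 \<le> v\<^sub>0" and el: "\<And>v. v\<^sub>0 \<le> v \<Longrightarrow> f v / v \<le> 2 * f' v"
    and inc: "\<And>a b. v\<^sub>0 \<le> a \<Longrightarrow> a \<le> b \<Longrightarrow> (f a)\<^sup>2 / a \<le> (f b)\<^sup>2 / b"
    using eventually_elastic by metis
  obtain T0 where T0: "0 \<le> T0" "\<And>r t. T0 \<le> r \<Longrightarrow> r \<le> t \<Longrightarrow> M / 2 * (t - r) \<le> F f (x t) - F f (x r)"
    using F_increment_ge[OF x] by blast
  have "\<forall>\<^sub>F t in at_top. T0 \<le> t \<and> v\<^sub>0 \<le> x t"
    using eventually_ge_at_top[of T0] x by (auto simp: filterlim_at_top intro: eventually_conj)
  then obtain T1 where T1: "T0 \<le> T1" "v\<^sub>0 \<le> x T1"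
    by (auto simp: eventually_at_top_linorder)
  define a where "a = x T1"
  have a: "1 \<le> a" "v\<^sub>0 \<le> a" "0 < a" using T1 v0 by (auto simp: a_def)
  have "filterlim (\<lambda>u. G (x u)) at_top at_top"
    by (rule filterlim_compose[OF G_at_top x])
  then have "\<forall>\<^sub>F u in at_top. T1 \<le> u \<and> 2 * G a \<le> G (x u)"
    using eventually_ge_at_top[of T1] by (auto simp: filterlim_at_top intro: eventually_conj)
  then obtain T where T: "\<And>u. T \<le> u \<Longrightarrow> T1 \<le> u \<and> 2 * G a \<le> G (x u)"
    by (auto simp: eventually_at_top_linorder)
  show ?thesis
  proof (rule that)
    show "0 \<le> T" "1 \<le> x T"
      using T[of T] T0 T1 a x_mono[of T1 T] by (auto simp: a_def)
    fix u s assume u: "T \<le> u" and s: "0 \<le> (s::real)"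
    define y where "y = x u"
    have u1: "T1 \<le> u" "2 * G a \<le> G y" using T[OF u] by (auto simp: y_def)
    have u0: "0 \<le> u" "y = X u" using u1 T0 T1 by (auto simp: y_def)
    have ay: "a \<le> y" using u1 T0 T1 x_mono[of T1 u] by (auto simp: a_def y_def)
    have Fay: "F f a \<le> F f y" using ay a F_le_iff[of a y] by auto
    \<comment> \<open>\<open>p\<close> is the position of the solution a time \<open>s\<close>
      earlier, and \<open>q\<close> below is that of the undelayed flow through \<open>y\<close>.
      Both are cut off at \<open>a\<close>, above which convexity of \<open>G\<close> holds.\<close>
    define p where "p = max a (X (u - s))"
    have p: "a \<le> p" "p \<le> y" "0 < p" "X (u - s) \<le> p"
      using ay a X_mono[of "u - s" u] s u0 by (auto simp: p_def)
    have "continuous_on {a..y} (F f)"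
      using a by (intro continuous_on_subset[OF F_cont]) auto
    then obtain q where q: "a \<le> q" "q \<le> y" "F f q = max (F f a) (F f y - M * s)"
      using IVT'[of "F f" a "max (F f a) (F f y - M * s)" y] ay Fay s M_pos
      by auto
    \<comment> \<open>The half-speed bound gives \<open>F f p \<le> F f y - M * s / 2\<close> when
      the earlier time is at least \<open>T1\<close>; otherwise \<open>p = a\<close>, and both terms
      on the right dominate \<open>F f a\<close>.\<close>
    have "2 * F f p \<le> F f q + F f y"
    proof (cases "T1 \<le> u - s")
      case True
      then have "p = x (u - s)" using T0 T1 x_mono[of T1 "u - s"] by (auto simp: p_def a_def)
      then show ?thesis using T0(2)[of "u - s" u] True T1 s q(3) by (simp add: y_def)
    next
      case False
      then have "p = a" using X_mono[of "u - s" T1] T0 T1 by (auto simp: p_def a_def)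
      then show ?thesis using q Fay by auto
    qed
    then have "G y - G q \<le> 2 * (G y - G p)"
      using a p q by (intro G_diff_halving inc) auto
    also have "\<dots> \<le> 2 * (2 * (f y - f p))"
      using a p by (intro mult_left_mono G_diff_le_f_diff el) auto
    also have "\<dots> \<le> 4 * (e u - e (u - s))"
      using f_mono[OF X_pos p(4)] by (simp add: e_def u0(2))
    finally have G: "G y - G q \<le> 4 * (e u - e (u - s))" .
    define c where "c = (if F f a \<le> F f y - M * s then q else 1)"
    have c: "1 \<le> c" "c \<le> y" using q a ay by (auto simp: c_def)
    have "(\<integral>\<^sup>+v. ennreal (f (max 1 v) / max 1 v) *
        (if 1 \<le> v \<and> v \<le> y \<and> F f (max 1 y) - F f (max 1 v) \<le> M * s then 1 else 0) \<partial>lborel)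
      \<le> (\<integral>\<^sup>+v. ennreal (f (max 1 v) / max 1 v) * indicator {c..y} v \<partial>lborel)"
    proof (intro nn_integral_mono mult_left_mono)
      fix v
      have "q \<le> v" if "F f a \<le> F f y - M * s" "1 \<le> v" "F f y - F f v \<le> M * s"
        using that q a F_le_iff[of q v] by auto
      then show "(if 1 \<le> v \<and> v \<le> y \<and> F f (max 1 y) - F f (max 1 v) \<le> M * s then 1 else 0) \<le> (indicator {c..y} v :: ennreal)"
        using c by (auto simp: c_def max_def split: if_splits)
    qed simp
    also have "\<dots> = ennreal (G y - G c)"
      using c by (rule nn_integral_G)
    \<comment> \<open>If the flow would start below \<open>a\<close>, the range of \<open>v\<close>
      is enlarged down to \<open>1\<close>. As \<open>2 * G a \<le> G y\<close>, this at most
      doubles the increment from \<open>a\<close>, whence \<open>8\<close> instead of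
      \<open>4\<close>.\<close>
    also have "G y - G c \<le> 8 * (e u - e (u - s))"
    proof (cases "F f a \<le> F f y - M * s")
      case True
      then show ?thesis using G e_mono[of "u - s" u] s by (simp add: c_def)
    next
      case False
      then have "q = a" using q a F_le_iff[of q a] by auto
      then show ?thesis using G False u1(2) by (simp add: c_def)
    qed
    finally show "(\<integral>\<^sup>+v. ennreal (f (max 1 v) / max 1 v) *
        (if 1 \<le> v \<and> v \<le> x u \<and> F f (max 1 (x u)) - F f (max 1 v) \<le> M * s then 1 else 0) \<partial>lborel)
      \<le> ennreal (8 * (e u - e (u - s)))"
      by (simp add: y_def ennreal_leI)
  qed
qed

text \<open>Tonelli makes the lag integral the outer one; integrating the lag estimate over
  \<open>\<nu>\<close> then reproduces \<open>e u * B u\<close>.\<close>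

lemma K_hat_le:
  assumes x: "filterlim x at_top at_top"
  obtains T where "0 \<le> T" "1 \<le> x T" "\<And>u. T \<le> u \<Longrightarrow> K_hat (x u) \<le> ennreal (8 * (e u * B u))"
proof -
  obtain T where T: "0 \<le> T" "1 \<le> x T"
    and lag: "\<And>u s. T \<le> u \<Longrightarrow> 0 \<le> s \<Longrightarrow>
      (\<integral>\<^sup>+v. ennreal (f (max 1 v) / max 1 v) *
        (if 1 \<le> v \<and> v \<le> x u \<and> F f (max 1 (x u)) - F f (max 1 v) \<le> M * s then 1 else 0) \<partial>lborel)
      \<le> ennreal (8 * (e u - e (u - s)))"
    using lag_estimate[OF x] by blast
  interpret pair_sigma_finite lborel \<nu>
    by unfold_locales
  have "K_hat (x u) \<le> ennreal (8 * (e u * B u))" if u: "T \<le> u" for u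
  proof -
    have "K_hat (x u) = (\<integral>\<^sup>+s. \<integral>\<^sup>+v. ennreal (f (max 1 v) / max 1 v) *
        (if 1 \<le> v \<and> v \<le> x u \<and> F f (max 1 (x u)) - F f (max 1 v) \<le> M * s then 1 else 0) \<partial>lborel \<partial>\<nu>)"
      unfolding K_hat_def by (rule Fubini'[symmetric]) measurable
    also have "\<dots> \<le> (\<integral>\<^sup>+s. ennreal (8 * (e u - e (u - s))) \<partial>\<nu>)"
      by (intro nn_integral_mono_AE eventually_mono[OF \<nu>_nonneg] lag[OF u])
    also have "\<dots> = ennreal (LINT s|\<nu>. 8 * (e u - e (u - s)))"
      using \<nu>_nonneg integrable_e_diff[of u]
      by (intro nn_integral_eq_integral) (auto elim!: eventually_mono intro: e_mono)
    also have "(LINT s|\<nu>. 8 * (e u - e (u - s))) = 8 * (e u * B u)"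
      using integrable_e_diff[of u] e_pos[of u] by (simp add: B_eq algebra_simps)
    finally show ?thesis .
  qed
  with T show ?thesis by (rule that)
qed

lemma tail_le_B:
  assumes x: "filterlim x at_top at_top"
  obtains T where "0 \<le> T" "\<And>u. T \<le> u \<Longrightarrow> measure \<nu> {u..} \<le> 2 * B u"
proof -
  have "\<forall>\<^sub>F u in at_top. 0 \<le> u \<and> 2 * e 0 \<le> f (x u)"
    using eventually_ge_at_top[of 0] filterlim_compose[OF f_at_top x]
    by (auto simp: filterlim_at_top intro: eventually_conj)
  then obtain T where T: "\<And>u. T \<le> u \<Longrightarrow> 0 \<le> u \<and> 2 * e 0 \<le> f (x u)"
    by (auto simp: eventually_at_top_linorder)
  have "measure \<nu> {u..} \<le> 2 * B u" if "T \<le> u" for u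
  proof -
    have u: "0 \<le> u" "2 * e 0 \<le> e u" using T[OF that] by (auto simp: e_def)
    have "measure \<nu> {u..} / 2 = (LINT s|\<nu>. indicat_real {u..} s * (1/2))"
      by (simp add: sets_\<nu>)
    also have "\<dots> \<le> B u"
      unfolding B_def
    proof (intro integral_mono_AE)
      show "AE s in \<nu>. indicat_real {u..} s * (1/2) \<le> 1 - e (u - s) / e u"
        using \<nu>_nonneg
      proof eventually_elim
        case (elim s)
        have "e (u - s) \<le> e u" using elim by (intro e_mono) simp
        moreover have "2 * e (u - s) \<le> e u" if "u \<le> s"
          using e_mono[of "u - s" 0] u that by simp
        ultimately show ?case using e_pos[of u] by (auto simp: indicator_def field_simps)
      qed
    qed (auto intro!: integrable_e_diff simp: sets_\<nu> less_top[symmetric])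
    finally show ?thesis by simp
  qed
  moreover have "0 \<le> T" using T[of T] by simp
  ultimately show ?thesis using that by blast
qed

text \<open>A continuous unbounded \<open>x\<close> attains every level above \<open>x T\<close>, so
  a limit along the solution is a limit in the space variable, without inverting
  \<open>x\<close>.\<close>

lemma tendsto_0_along_x:
  assumes x: "filterlim x at_top at_top" and P: "(P \<longlongrightarrow> 0) at_top"
    and Q: "\<forall>\<^sub>F t in at_top. \<bar>Q (x t)\<bar> \<le> (P t :: real)"
  shows "(Q \<longlongrightarrow> 0) at_top"
proof (rule tendstoI)
  fix \<epsilon> :: real assume "0 < \<epsilon>"
  with P have "\<forall>\<^sub>F t in at_top. P t < \<epsilon>" by (rule order_tendstoD)
  with Q have "\<forall>\<^sub>F t in at_top. \<bar>Q (x t)\<bar> < \<epsilon>" by eventually_elim simp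
  then obtain T' where T': "\<And>t. T' \<le> t \<Longrightarrow> \<bar>Q (x t)\<bar> < \<epsilon>"
    by (auto simp: eventually_at_top_linorder)
  define T where "T = max 0 T'"
  have "dist (Q y) 0 < \<epsilon>" if y: "x T \<le> y" for y
  proof -
    have "\<forall>\<^sub>F t in at_top. T \<le> t \<and> y \<le> x t"
      using eventually_ge_at_top[of T] x by (auto simp: filterlim_at_top intro: eventually_conj)
    then obtain t1 where "T \<le> t1" "y \<le> x t1"
      by (auto simp: eventually_at_top_linorder)
    then obtain t where "T \<le> t" "x t = y"
      using IVT'[of x T y t1] y continuous_on_subset[OF x_cont, of "{T..t1}"] by (auto simp: T_def)
    then show ?thesis using T'[of t] by (auto simp: T_def)
  qed
  then show "\<forall>\<^sub>F y in at_top. dist (Q y) 0 < \<epsilon>"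
    by (auto simp: eventually_at_top_linorder)
qed

subsection \<open>Solutions close to the undelayed flow\<close>

context
  assumes asymp: "((\<lambda>t. x t / F_inv f (M * t)) \<longlongrightarrow> 1) at_top"
begin

lemma x_at_top: "filterlim x at_top at_top"
proof -
  have "filterlim (\<lambda>t. F_inv f (M * t)) at_top at_top"
    unfolding filterlim_at_top
  proof
    fix N :: real
    show "\<forall>\<^sub>F t in at_top. N \<le> F_inv f (M * t)"
      using eventually_ge_at_top[of "max 0 (F f (max 1 N) / M)"]
    proof eventually_elim
      case (elim t)
      then have "0 \<le> M * t" "F f (max 1 N) \<le> M * t"
        using M_pos by (auto simp: field_simps)
      then have "max 1 N \<le> F_inv f (M * t)"
        using F_inv[of "M * t"] F_le_iff[of "max 1 N" "F_inv f (M * t)"] by auto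
      then show ?case by simp
    qed
  qed
  then have "filterlim (\<lambda>t. x t / F_inv f (M * t) * F_inv f (M * t)) at_top at_top"
    by (intro filterlim_tendsto_pos_mult_at_top[OF asymp]) simp
  moreover have "\<forall>\<^sub>F t in at_top. x t / F_inv f (M * t) * F_inv f (M * t) \<le> x t"
    using eventually_ge_at_top[of 0]
  proof eventually_elim
    case (elim t)
    then show ?case using F_inv(1)[of "M * t"] M_pos by simp
  qed
  ultimately show ?thesis by (rule filterlim_at_top_mono)
qed

text \<open>With \<open>a = x t\<close> and \<open>b = F_inv f (M * t)\<close> the deficit is
  \<open>F f b - F f a\<close>. After weighting by \<open>f a / a\<close> it is at most
  \<open>b / a - 1\<close> if \<open>a \<le> b\<close>, and otherwise at most
  \<open>a / b - 1\<close> in modulus, since \<open>f y / y\<close> decreases.\<close>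

lemma deficit_tendsto_0: "((\<lambda>t. f (x t) / x t * (M * t - F f (x t))) \<longlongrightarrow> 0) at_top"
proof (rule Lim_null_comparison)
  let ?b = "\<lambda>t. F_inv f (M * t)"
  have "((\<lambda>t. \<bar>x t / ?b t - 1\<bar> + \<bar>inverse (x t / ?b t) - 1\<bar>) \<longlongrightarrow> \<bar>1 - 1\<bar> + \<bar>inverse 1 - 1\<bar>) at_top"
    by (intro tendsto_intros asymp) auto
  then show "((\<lambda>t. \<bar>x t / ?b t - 1\<bar> + \<bar>inverse (x t / ?b t) - 1\<bar>) \<longlongrightarrow> 0) at_top" by simp
  show "\<forall>\<^sub>F t in at_top. norm (f (x t) / x t * (M * t - F f (x t)))
      \<le> \<bar>x t / ?b t - 1\<bar> + \<bar>inverse (x t / ?b t) - 1\<bar>"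
    using eventually_ge_at_top[of 0]
  proof eventually_elim
    case (elim t)
    define a b where "a = x t" and "b = ?b t"
    have ab: "0 < a" "0 < b" "F f b = M * t"
      using elim x_pos F_inv[of "M * t"] M_pos by (auto simp: a_def b_def)
    have "\<bar>f a / a * (F f b - F f a)\<bar> \<le> \<bar>a / b - 1\<bar> + \<bar>inverse (a / b) - 1\<bar>"
    proof (cases "a \<le> b")
      case True
      have "f a / a * (F f b - F f a) \<le> f a / a * ((b - a) / f a)"
        using F_diff_le[OF ab(1) True] f_pos[OF ab(1)] ab by (intro mult_left_mono) auto
      also have "\<dots> = inverse (a / b) - 1" using ab f_pos[OF ab(1)] by (simp add: field_simps)
      also have "\<dots> \<le> \<bar>a / b - 1\<bar> + \<bar>inverse (a / b) - 1\<bar>" by linarith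
      finally show ?thesis using True ab f_pos[OF ab(1)] F_le_iff[of a b] by (simp add: abs_of_nonneg)
    next
      case False
      then have "f a / a * (F f a - F f b) \<le> f b / b * ((a - b) / f b)"
        using F_diff_le[of b a] ratio_antimono[of b a] f_pos[of b] f_pos[of a] ab F_le_iff[of b a]
        by (intro mult_mono) auto
      also have "\<dots> = a / b - 1" using ab f_pos[OF ab(2)] by (simp add: field_simps)
      moreover have "\<bar>f a / a * (F f b - F f a)\<bar> = f a / a * (F f a - F f b)"
        using False ab f_pos[OF ab(1)] F_le_iff[of b a] by (simp add: abs_mult)
      ultimately show ?thesis by linarith
    qed
    then show ?case by (simp add: a_def[symmetric] b_def[symmetric] ab(3))
  qed
qed

lemma affine_deficit_tendsto_0:
  "((\<lambda>t. f (x t) / x t * (C + c * (M * t - F f (x t)))) \<longlongrightarrow> 0) at_top"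
proof -
  have "((\<lambda>t. f (x t) / x t) \<longlongrightarrow> 0) at_top"
    by (rule filterlim_compose[OF ratio_tendsto_0 x_at_top])
  then have "((\<lambda>t. C * (f (x t) / x t) + c * (f (x t) / x t * (M * t - F f (x t)))) \<longlongrightarrow> C * 0 + c * 0) at_top"
    by (intro tendsto_intros deficit_tendsto_0)
  then show ?thesis by (simp add: algebra_simps)
qed

lemma tail_integral_tendsto_0:
  "((\<lambda>y. f y / y * (LBINT s:{0..F f y / M}. measure \<nu> {s..})) \<longlongrightarrow> 0) at_top"
proof -
  obtain T where T: "0 \<le> T" "\<And>u. T \<le> u \<Longrightarrow> measure \<nu> {u..} \<le> 2 * B u"
    using tail_le_B[OF x_at_top] by blast
  \<comment> \<open>The range of integration ends at \<open>F f (x t) / M\<close>, which can exceed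
    \<open>t\<close> by at most \<open>c\<close>. The range is therefore cut at \<open>T\<close> and
    \<open>t\<close>, with the tail bounded by \<open>M\<close> on the outer pieces and by
    \<open>2 * B\<close> on the middle one.\<close>
  define c where "c = \<bar>F f \<psi>\<bar> / M"
  have c: "0 \<le> c" using M_pos by (simp add: c_def)
  define C where "C = M * T + M * c + 2 * (F f (x T) - M * T)"
  show ?thesis
  proof (rule tendsto_0_along_x[OF x_at_top affine_deficit_tendsto_0[of C 2]])
    show "\<forall>\<^sub>F t in at_top. \<bar>f (x t) / x t * (LBINT s:{0..F f (x t) / M}. measure \<nu> {s..})\<bar>
      \<le> f (x t) / x t * (C + 2 * (M * t - F f (x t)))"
      using eventually_ge_at_top[of T]
    proof eventually_elim
      case (elim t)
      have "F f (x t) \<le> M * t + F f \<psi>"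
        using F_increment_le[of 0 t] elim T by (simp add: x_0)
      then have Ft: "F f (x t) / M \<le> t + c"
        using M_pos by (auto simp: c_def field_simps)
      define D where "D = M * (t - T) - (F f (x t) - F f (x T))"
      have D: "0 \<le> D" using F_increment_le[of T t] elim T by (simp add: D_def)
      have "(LBINT s:{0..F f (x t) / M}. measure \<nu> {s..}) \<le> M * T + M * c + 2 * D"
        unfolding set_lebesgue_integral_def
      proof (rule integral_real_bounded)
        have "(\<integral>\<^sup>+s. ennreal (indicat_real {0..F f (x t) / M} s *\<^sub>R measure \<nu> {s..}) \<partial>lborel)
          \<le> (\<integral>\<^sup>+s. (ennreal M * indicator {0..T} s + ennreal M * indicator {t..t + c} s)
                + ennreal 2 * (ennreal (B s) * indicator {T..t} s) \<partial>lborel)"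
        proof (intro nn_integral_mono)
          fix s :: real
          have *: "ennreal (measure \<nu> {s..}) \<le> ennreal M"
            by (intro ennreal_leI) (use bounded_measure[of "{s..}"] in simp)
          consider "s \<notin> {0..F f (x t) / M}" | "s \<in> {0..T}" | "s \<in> {T..t}" | "s \<in> {t..t+c}"
            using Ft by force
          then show "ennreal (indicat_real {0..F f (x t) / M} s *\<^sub>R measure \<nu> {s..})
            \<le> (ennreal M * indicator {0..T} s + ennreal M * indicator {t..t + c} s)
                + ennreal 2 * (ennreal (B s) * indicator {T..t} s)"
          proof cases
            case 2
            then show ?thesis using * by (auto simp: indicator_def add.assoc intro!: add_increasing2)
          next
            case 3
            then have "ennreal (measure \<nu> {s..}) \<le> ennreal 2 * ennreal (B s)"
              using T(2)[of s] B_nonneg[of s] by (subst ennreal_mult[symmetric]) (auto intro: ennreal_leI)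
            then show ?thesis using 3 by (auto simp: indicator_def intro: add_increasing)
          next
            case 4
            then show ?thesis using * by (auto simp: indicator_def add.assoc intro!: add_increasing2)
          qed simp
        qed
        also have "\<dots> = (\<integral>\<^sup>+s. ennreal M * indicator {0..T} s \<partial>lborel) + (\<integral>\<^sup>+s. ennreal M * indicator {t..t + c} s \<partial>lborel)
            + ennreal 2 * (\<integral>\<^sup>+s. ennreal (B s) * indicator {T..t} s \<partial>lborel)"
          by (simp add: nn_integral_add nn_integral_cmult)
        also have "\<dots> \<le> ennreal (M * T) + ennreal (M * c) + ennreal 2 * ennreal D"
          unfolding D_def using T elim c
          by (intro add_mono mult_left_mono nn_integral_B_le) (auto simp: nn_integral_cmult_indicator ennreal_mult)
        also have "\<dots> = ennreal (M * T + M * c + 2 * D)"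
          using T c D by (simp add: ennreal_mult)
        finally show "(\<integral>\<^sup>+s. ennreal (indicat_real {0..F f (x t) / M} s *\<^sub>R measure \<nu> {s..}) \<partial>lborel)
          \<le> ennreal (M * T + M * c + 2 * D)" .
      qed (use T c D in auto)
      also have "\<dots> = C + 2 * (M * t - F f (x t))" by (simp add: C_def D_def algebra_simps)
      finally have le: "(LBINT s:{0..F f (x t) / M}. measure \<nu> {s..}) \<le> C + 2 * (M * t - F f (x t))" .
      have "0 \<le> (LBINT s:{0..F f (x t) / M}. measure \<nu> {s..})"
        unfolding set_lebesgue_integral_def by (intro integral_nonneg_AE) auto
      moreover have "0 < f (x t) / x t" using elim T by (auto intro!: divide_pos_pos f_pos x_pos)
      ultimately show ?case
        using le by (subst abs_of_nonneg) (auto simp del: times_divide_eq_left intro!: mult_left_mono mult_nonneg_nonneg)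
    qed
  qed
qed

lemma K_integral_tendsto_0:
  "((\<lambda>y. f y / y * (LBINT u:{1..y}. K\<^sub>\<nu> u * (1 / (f u)\<^sup>2))) \<longlongrightarrow> 0) at_top"
proof -
  obtain T where T: "0 \<le> T" "1 \<le> x T"
    and K: "\<And>u. T \<le> u \<Longrightarrow> K_hat (x u) \<le> ennreal (8 * (e u * B u))"
    using K_hat_le[OF x_at_top] by blast
  define b where "b = x T"
  \<comment> \<open>\<open>C1\<close> bounds the integral over \<open>[1, b]\<close>: a bound for
    the kernel, the largest value of the weight, and the length \<open>b - 1\<close>.\<close>
  define C1 where "C1 = f 1 * M * (b - 1) * (1 / (f 1)\<^sup>2) * (b - 1)"
  define C where "C = C1 + 8 * M * (F f (x T) - M * T)"
  have b: "1 \<le> b" using T by (simp add: b_def)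
  have C1: "0 \<le> C1" using b f_pos[of 1] M_pos by (simp add: C1_def)
  show ?thesis
  proof (rule tendsto_0_along_x[OF x_at_top affine_deficit_tendsto_0[of C "8 * M"]])
    show "\<forall>\<^sub>F t in at_top. \<bar>f (x t) / x t * (LBINT u:{1..x t}. K\<^sub>\<nu> u * (1 / (f u)\<^sup>2))\<bar>
      \<le> f (x t) / x t * (C + 8 * M * (M * t - F f (x t)))"
      using eventually_ge_at_top[of T]
    proof eventually_elim
      case (elim t)
      define D where "D = M * (t - T) - (F f (x t) - F f (x T))"
      have D: "0 \<le> D" using F_increment_le[of T t] elim T by (simp add: D_def)
      \<comment> \<open>Substituting \<open>y = x u\<close> turns the integral of this majorant into
        one with density at most \<open>8 * M * B u\<close>, because
        \<open>w u \<le> e u * M\<close> cancels the remaining power of \<open>e u\<close>.\<close>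
      define k where "k y = K_hat y * ennreal (1 / (f (max 1 y))\<^sup>2)" for y
      have k [measurable]: "k \<in> borel_measurable borel" unfolding k_def by measurable
      have "(\<integral>\<^sup>+y. k y * indicator {x T..x t} y \<partial>lborel) = (\<integral>\<^sup>+u. k (X u) * ennreal (w u) * indicator {T..t} u \<partial>lborel)"
        using T elim by (intro nn_integral_substitution) auto
      also have "\<dots> \<le> (\<integral>\<^sup>+u. ennreal (8 * M) * (ennreal (B u) * indicator {T..t} u) \<partial>lborel)"
      proof (intro nn_integral_mono)
        fix u
        have "k (X u) * ennreal (w u) \<le> ennreal (8 * M) * ennreal (B u)" if u: "T \<le> u"
        proof -
          have xu: "X u = x u" "1 \<le> x u" using u T x_mono[of T u] by auto
          have "k (X u) * ennreal (w u) \<le> ennreal (8 * (e u * B u)) * ennreal (1 / (e u)\<^sup>2) * ennreal (e u * M)"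
            unfolding k_def using K[OF u] xu w_le_M[of u]
            by (intro mult_mono ennreal_leI) (auto simp: e_def max_def)
          also have "\<dots> = ennreal (8 * (e u * B u) * (1 / (e u)\<^sup>2) * (e u * M))"
            using e_pos[of u] B_nonneg[of u] M_pos by (simp add: ennreal_mult[symmetric])
          also have "8 * (e u * B u) * (1 / (e u)\<^sup>2) * (e u * M) = 8 * M * B u"
            using e_pos[of u] by (simp add: power2_eq_square)
          finally show ?thesis using M_pos B_nonneg[of u] by (simp add: ennreal_mult)
        qed
        then show "k (X u) * ennreal (w u) * indicator {T..t} u \<le> ennreal (8 * M) * (ennreal (B u) * indicator {T..t} u)"
          by (auto simp: indicator_def)
      qed
      also have "\<dots> = ennreal (8 * M) * (\<integral>\<^sup>+u. ennreal (B u) * indicator {T..t} u \<partial>lborel)"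
        by (intro nn_integral_cmult) auto
      also have "\<dots> \<le> ennreal (8 * M) * ennreal D"
        unfolding D_def using T elim by (intro mult_left_mono nn_integral_B_le) auto
      finally have k_le: "(\<integral>\<^sup>+y. k y * indicator {x T..x t} y \<partial>lborel) \<le> ennreal (8 * M * D)"
        using M_pos D by (simp add: ennreal_mult)
      have "(LBINT u:{1..x t}. K\<^sub>\<nu> u * (1 / (f u)\<^sup>2)) \<le> C1 + 8 * M * D"
        unfolding set_lebesgue_integral_def
      proof (rule integral_real_bounded)
        have "(\<integral>\<^sup>+y. ennreal (indicat_real {1..x t} y *\<^sub>R (K\<^sub>\<nu> y * (1 / (f y)\<^sup>2))) \<partial>lborel)
          \<le> (\<integral>\<^sup>+y. ennreal (f 1 * M * (b - 1) * (1 / (f 1)\<^sup>2)) * indicator {1..b} y + k y * indicator {x T..x t} y \<partial>lborel)"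
        proof (intro nn_integral_mono)
          fix y :: real
          consider "y \<notin> {1..x t}" | "y \<in> {1..b}" | "y \<in> {b..x t}" by force
          then show "ennreal (indicat_real {1..x t} y *\<^sub>R (K\<^sub>\<nu> y * (1 / (f y)\<^sup>2)))
            \<le> ennreal (f 1 * M * (b - 1) * (1 / (f 1)\<^sup>2)) * indicator {1..b} y + k y * indicator {x T..x t} y"
          proof cases
            case 2
            then have "1 / (f y)\<^sup>2 \<le> 1 / (f 1)\<^sup>2"
              using f_pos[of 1] f_pos[of y] f_mono[of 1 y] by (intro divide_left_mono power_mono) auto
            then have "K\<^sub>\<nu> y * (1 / (f y)\<^sup>2) \<le> f 1 * M * (b - 1) * (1 / (f 1)\<^sup>2)"
              using K_bounded[of y b] 2 K_nonneg[of y] f_pos[of 1] M_pos b by (intro mult_mono) auto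
            then have "ennreal (K\<^sub>\<nu> y * (1 / (f y)\<^sup>2)) \<le> ennreal (f 1 * M * (b - 1) * (1 / (f 1)\<^sup>2))"
              by (rule ennreal_leI)
            then show ?thesis using 2 by (auto simp: indicator_def intro: add_increasing2)
          next
            case 3
            then have "max 1 y = y" "K\<^sub>\<nu> y \<le> K_hat y" using b K_le_K_hat[of y] by auto
            then have "ennreal (K\<^sub>\<nu> y * (1 / (f y)\<^sup>2)) \<le> k y"
              unfolding k_def using K_nonneg[of y]
              by (subst ennreal_mult) (auto intro!: mult_right_mono)
            then show ?thesis using 3 b by (auto simp: b_def indicator_def intro: add_increasing)
          qed simp
        qed
        also have "\<dots> = (\<integral>\<^sup>+y. ennreal (f 1 * M * (b - 1) * (1 / (f 1)\<^sup>2)) * indicator {1..b} y \<partial>lborel)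
            + (\<integral>\<^sup>+y. k y * indicator {x T..x t} y \<partial>lborel)"
          by (intro nn_integral_add) auto
        also have "\<dots> \<le> ennreal C1 + ennreal (8 * M * D)"
        proof (rule add_mono[OF _ k_le])
          show "(\<integral>\<^sup>+y. ennreal (f 1 * M * (b - 1) * (1 / (f 1)\<^sup>2)) * indicator {1..b} y \<partial>lborel) \<le> ennreal C1"
            unfolding C1_def using b M_pos f_pos[of 1]
            by (subst nn_integral_cmult_indicator) (auto simp: ennreal_mult[symmetric])
        qed
        also have "\<dots> = ennreal (C1 + 8 * M * D)"
          using C1 D M_pos by simp
        finally show "(\<integral>\<^sup>+y. ennreal (indicat_real {1..x t} y *\<^sub>R (K\<^sub>\<nu> y * (1 / (f y)\<^sup>2))) \<partial>lborel) \<le> ennreal (C1 + 8 * M * D)" .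
      qed (use C1 D M_pos in auto)
      also have "\<dots> = C + 8 * M * (M * t - F f (x t))" by (simp add: C_def D_def algebra_simps)
      finally have le: "(LBINT u:{1..x t}. K\<^sub>\<nu> u * (1 / (f u)\<^sup>2)) \<le> C + 8 * M * (M * t - F f (x t))" .
      have "0 \<le> (LBINT u:{1..x t}. K\<^sub>\<nu> u * (1 / (f u)\<^sup>2))"
        unfolding set_lebesgue_integral_def using K_nonneg by (intro integral_nonneg_AE) auto
      moreover have "0 < f (x t) / x t" using elim T by (auto intro!: divide_pos_pos f_pos x_pos)
      ultimately show ?case
        using le by (subst abs_of_nonneg) (auto simp del: times_divide_eq_left intro!: mult_left_mono mult_nonneg_nonneg)
    qed
  qed
qed

end
end

section \<open>Transfer from the half-line measure to its image on the real line\<close>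

theorem theorem6:
  fixes f f' x :: "real \<Rightarrow> real" and \<mu> :: "real measure" and \<psi> M :: real
  assumes f_pos: "\<And>y. 0 < y \<Longrightarrow> 0 < f y"
    and f_deriv: "\<And>y. 0 < y \<Longrightarrow> (f has_real_derivative f' y) (at y)"
    and f'_cont: "continuous_on {0<..} f'"
    and f'_pos: "\<And>y. 0 < y \<Longrightarrow> 0 < f' y"
    and f'_decreasing: "antimono_on {0<..} f'"
    and f'_lim: "(f' \<longlongrightarrow> 0) at_top"
    and f_rv: "regularly_varying_at_infinity 1 f"
    and f_elasticity: "((\<lambda>y. y * f' y / f y) \<longlongrightarrow> 1) at_top"
    and \<mu>: "finite_Borel_measure_halfline \<mu>"
    and M_def: "M = total_mass \<mu>"
    and M_pos: "0 < M"
    and \<psi>_pos: "0 < \<psi>"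
    and solution: "volterra_solution f \<mu> \<psi> x"
    and asymp: "((\<lambda>t. x t / F_inv f (M * t)) \<longlongrightarrow> 1) at_top"
  shows "((\<lambda>y. f y / y * (LBINT s:{0..F f y / M}. measure \<mu> {s..})) \<longlongrightarrow> 0) at_top \<and>
         ((\<lambda>y. f y / y * (LBINT u:{1..y}. K f \<mu> u * (1 / (f u)^2))) \<longlongrightarrow> 0) at_top"
proof -
  interpret growth: sublinear_growth f f'
    by unfold_locales (fact f_pos f_deriv f'_pos f'_decreasing f'_lim f_elasticity)+
  define \<nu> where "\<nu> = distr \<mu> borel (\<lambda>s. s)"
  interpret \<mu>: finite_measure \<mu> using \<mu> by (simp add: finite_Borel_measure_halfline_def)
  have sets: "sets \<mu> = sets (restrict_space borel {0..})"
    using \<mu> by (simp add: finite_Borel_measure_halfline_def)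
  have space: "space \<mu> = {0..}"
    using sets_eq_imp_space_eq[OF sets] by (simp add: space_restrict_space)
  have id [measurable]: "(\<lambda>s. s) \<in> borel_measurable \<mu>"
    unfolding measurable_cong_sets[OF sets refl] by (intro measurable_restrict_space1) simp
  have measure_\<nu>: "measure \<nu> A = measure \<mu> A" if "A \<subseteq> {0..}" "A \<in> sets borel" for A
    using that space unfolding \<nu>_def by (subst measure_distr) (auto simp: Int_absorb2 vimage_def)
  have M: "measure \<nu> UNIV = M"
    unfolding \<nu>_def M_def total_mass_def by (subst measure_distr) (auto simp: space)
  have LINT_\<nu>: "(LINT s:{0..u}|\<nu>. f (x (u - s))) = (LINT s:{0..u}|\<mu>. f (x (u - s)))" if "0 \<le> u" for u
  proof -
    \<comment> \<open>Extension by zero outside \<open>{0..u}\<close> gives a Borel function on the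
      whole line, as the change of variables requires.\<close>
    define h where "h s = (if s \<in> {0..u} then f (x (u - s)) else 0)" for s
    have "continuous_on {0..u} (\<lambda>s. f (x (u - s)))"
      using solution
      by (intro continuous_on_compose2[OF growth.f_cont continuous_on_compose2[of "{0..}" x]] continuous_intros)
        (auto simp: volterra_solution_def)
    then have [measurable]: "h \<in> borel_measurable borel"
      unfolding h_def by (intro borel_measurable_continuous_on_if) auto
    have "(LINT s:{0..u}|N. f (x (u - s))) = (LINT s|N. h s)" for N :: "real measure"
      unfolding set_lebesgue_integral_def h_def by (intro Bochner_Integration.integral_cong) auto
    moreover have "(LINT s|\<nu>. h s) = (LINT s|\<mu>. h s)"
      unfolding \<nu>_def by (intro integral_distr) auto
    ultimately show ?thesis by simp
  qed
  have \<nu>_finite: "finite_measure \<nu>"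
    unfolding \<nu>_def by (rule \<mu>.finite_measure_distr) (rule id)
  interpret delay: delay_equation f f' \<nu> x \<psi>
  proof (intro delay_equation.intro growth.sublinear_growth_axioms \<nu>_finite delay_equation_axioms.intro)
    show "sets \<nu> = sets borel" by (simp add: \<nu>_def)
    show "AE s in \<nu>. 0 \<le> s"
      unfolding \<nu>_def by (subst AE_distr_iff) (auto simp: space)
    show "0 < measure \<nu> UNIV" using M M_pos by simp
    show "continuous_on {0..} x" "\<And>t. 0 \<le> t \<Longrightarrow> 0 < x t"
      using solution by (auto simp: volterra_solution_def)
    show "x t = \<psi> + (LBINT u:{0..t}. (LINT s:{0..u}|\<nu>. f (x (u - s))))" if "0 \<le> t" for t
    proof -
      have "(LBINT u:{0..t}. (LINT s:{0..u}|\<nu>. f (x (u - s)))) = (LBINT u:{0..t}. (LINT s:{0..u}|\<mu>. f (x (u - s))))"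
        by (intro set_lebesgue_integral_cong) (auto simp: LINT_\<nu>)
      then show ?thesis using solution that by (simp add: volterra_solution_def)
    qed
  qed
  have "(LBINT s:{0..F f y / M}. measure \<nu> {s..}) = (LBINT s:{0..F f y / M}. measure \<mu> {s..})" for y
    by (intro set_lebesgue_integral_cong) (auto simp: measure_\<nu>)
  moreover have "delay.K\<^sub>\<nu> y = K f \<mu> y" for y
    unfolding delay.K\<^sub>\<nu>_def K_def M M_def[symmetric]
  proof (intro set_lebesgue_integral_cong allI impI)
    \<comment> \<open>Monotonicity of \<open>F f\<close> makes the lower end of the lag window
      nonnegative, so both measures agree on it.\<close>
    fix v assume "v \<in> {1..y}"
    then have "F f v / M \<le> F f y / M"
      using M_pos growth.F_le_iff[of v y] by (intro divide_right_mono) auto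
    then have "measure \<nu> {F f y / M - F f v / M..F f y / M} = measure \<mu> {F f y / M - F f v / M..F f y / M}"
      by (intro measure_\<nu>) auto
    then show "f v / v * measure \<nu> {F f y / M - F f v / M..F f y / M} =
        f v / v * measure \<mu> {F f y / M - F f v / M..F f y / M}" by simp
  qed simp
  ultimately show ?thesis
    using delay.tail_integral_tendsto_0 delay.K_integral_tendsto_0 asymp unfolding M by simp
qed

end
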